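(* Let $(X,\omega)$ be a closed connected hermitian manifold with $\dim_{\mathbb{C}}X=n$. For $\psi\in C^\infty(X)$, let $\varphi\in C^\infty(X)\cap\mathrm{PSH}(X,\omega)$ be the unique solution of the complex Monge–Ampère equation $$(\omega+\sqrt{-1}\partial\overline\partial\varphi)^n=e^{\psi+c}\,\omega^n,\qquad \max_X\varphi=0,$$ for some $c\in\mathbb{R}$. Then $$e^{c}=\inf_{u\in C^\infty(X)\cap\mathrm{PSH}(X,\omega)}\ \max_X\frac{e^{-\psi}(\omega+\sqrt{-1}\partial\overline\partial u)^n}{\omega^n}.$$
   Context: Closed means compact without boundary. A hermitian metric is identified with its positive definite $(1,1)$-form $\omega$, which is not assumed to be closed. $\mathrm{PSH}(X,\omega)$ denotes the $\omega$-plurisubharmonic functions, i.e. for smooth $u$ the condition $\omega+\sqrt{-1}\partial\overline\partial u\ge0$. It is a known theorem (Tosatti–Weinkove) that for every $\psi\in C^\infty(X)$ there is a unique pair $(\varphi,c)$ solving the displayed Monge–Ampère equation. *)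

theory Defs
  imports "HOL-Analysis.Analysis"
begin

section \<open>Smooth and holomorphic maps on open sets\<close>

text \<open>\<open>Ck_on k f S\<close>, for open \<open>S\<close>: all iterated directional derivatives of \<open>f\<close>
  of order at most \<open>k\<close> exist on \<open>S\<close> and are continuous.\<close>

primrec Ck_on ::
    "nat \<Rightarrow> ('a::real_normed_vector \<Rightarrow> 'b::real_normed_vector) \<Rightarrow> 'a set \<Rightarrow> bool" where
  "Ck_on 0 f S \<longleftrightarrow> continuous_on S f"
| "Ck_on (Suc k) f S \<longleftrightarrow>
     (\<forall>x\<in>S. f differentiable (at x)) \<and>
     (\<forall>v. Ck_on k (\<lambda>x. frechet_derivative f (at x) v) S)"

definition smooth_on ::
    "'a set \<Rightarrow> ('a::real_normed_vector \<Rightarrow> 'b::real_normed_vector) \<Rightarrow> bool" where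
  "smooth_on S f \<longleftrightarrow> (\<forall>k. Ck_on k f S)"

definition holomorphic_map_on ::
    "(complex^'n) set \<Rightarrow> (complex^'n::finite \<Rightarrow> complex^'m::finite) \<Rightarrow> bool" where
  "holomorphic_map_on S f \<longleftrightarrow>
     (\<forall>z\<in>S. \<exists>L. (f has_derivative L) (at z) \<and> (\<forall>c v. L (c *s v) = c *s L v))"

section \<open>Compact complex manifolds\<close>

text \<open>A chart is a pair of a coordinate domain and a coordinate map; the values of the
  coordinate map outside the domain are irrelevant.  The complex dimension is \<open>CARD('n)\<close>.\<close>

type_synonym ('a, 'n) chart = "'a set \<times> ('a \<Rightarrow> complex^'n)"

abbreviation chart_dom :: "('a, 'n) chart \<Rightarrow> 'a set" where
  "chart_dom \<equiv> fst"

abbreviation coord :: "('a, 'n) chart \<Rightarrow> 'a \<Rightarrow> complex^'n" where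
  "coord \<equiv> snd"

definition chart_inv :: "('a, 'n) chart \<Rightarrow> complex^'n \<Rightarrow> 'a" where
  "chart_inv \<kappa> = inv_into (chart_dom \<kappa>) (coord \<kappa>)"

definition transition ::
    "('a, 'n) chart \<Rightarrow> ('a, 'n) chart \<Rightarrow> complex^'n \<Rightarrow> complex^'n" where
  "transition \<kappa> \<kappa>' = coord \<kappa>' \<circ> chart_inv \<kappa>"

definition is_chart :: "'a topology \<Rightarrow> ('a, 'n::finite) chart \<Rightarrow> bool" where
  "is_chart X \<kappa> \<longleftrightarrow>
     openin X (chart_dom \<kappa>) \<and> open (coord \<kappa> ` chart_dom \<kappa>) \<and>
     homeomorphic_map (subtopology X (chart_dom \<kappa>))
       (top_of_set (coord \<kappa> ` chart_dom \<kappa>)) (coord \<kappa>)"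

text \<open>The atlas \<open>A\<close> need not be maximal.\<close>

definition complex_manifold :: "'a topology \<Rightarrow> ('a, 'n::finite) chart set \<Rightarrow> bool" where
  "complex_manifold X A \<longleftrightarrow>
     topspace X \<noteq> {} \<and> Hausdorff_space X \<and> second_countable X \<and>
     (\<forall>\<kappa>\<in>A. is_chart X \<kappa>) \<and> (\<Union>\<kappa>\<in>A. chart_dom \<kappa>) = topspace X \<and>
     (\<forall>\<kappa>\<in>A. \<forall>\<kappa>'\<in>A. holomorphic_map_on
        (coord \<kappa> ` (chart_dom \<kappa> \<inter> chart_dom \<kappa>')) (transition \<kappa> \<kappa>'))"

definition smooth_fun :: "('a, 'n::finite) chart set \<Rightarrow> ('a \<Rightarrow> real) \<Rightarrow> bool" where
  "smooth_fun A u \<longleftrightarrow>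
     (\<forall>\<kappa>\<in>A. smooth_on (coord \<kappa> ` chart_dom \<kappa>) (u \<circ> chart_inv \<kappa>))"

section \<open>Exterior algebra of a coordinate tangent space\<close>

text \<open>Complex-valued, real-multilinear forms of any degree on the tangent space, which is
  identified with \<open>complex^'n\<close> by a chart.  A \<open>k\<close>-form only looks at the first \<open>k\<close>
  entries of the sequence of tangent vectors it is applied to.\<close>

type_synonym 'n form = "(nat \<Rightarrow> complex^'n) \<Rightarrow> complex"

definition wedge :: "nat \<Rightarrow> nat \<Rightarrow> 'n form \<Rightarrow> 'n form \<Rightarrow> 'n form" where
  "wedge p q \<alpha> \<beta> = (\<lambda>v. (\<Sum>\<sigma> | \<sigma> permutes {..<p + q}.
      of_int (sign \<sigma>) * \<alpha> (\<lambda>i. v (\<sigma> i)) * \<beta> (\<lambda>i. v (\<sigma> (p + i)))) / (fact p * fact q))"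

text \<open>\<open>\<alpha>\<close> is a 2-form.\<close>

primrec wedge_power :: "'n form \<Rightarrow> nat \<Rightarrow> 'n form" where
  "wedge_power \<alpha> 0 = (\<lambda>v. 1)"
| "wedge_power \<alpha> (Suc k) = wedge 2 (2 * k) \<alpha> (wedge_power \<alpha> k)"

definition dz :: "'n::finite \<Rightarrow> 'n form" where
  "dz j = (\<lambda>v. v 0 $ j)"

definition dzbar :: "'n::finite \<Rightarrow> 'n form" where
  "dzbar j = (\<lambda>v. cnj (v 0 $ j))"

definition form11 :: "complex^'n^'n \<Rightarrow> 'n::finite form" where
  "form11 H = (\<lambda>v. \<Sum>j\<in>UNIV. \<Sum>k\<in>UNIV. H $ j $ k * wedge 1 1 (dz j) (dzbar k) v)"

text \<open>\<open>\<alpha>(v, Jv)\<close>, where the complex structure \<open>J\<close> is multiplication by \<open>\<i>\<close>.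
  For \<open>\<alpha> = \<i> \<Sum> h\<^sub>j\<^sub>k dz\<^sub>j \<and> d\<zeta>\<^sub>k\<close> with \<open>\<zeta>\<^sub>k = cnj z\<^sub>k\<close> it equals
  \<open>2 \<Sum> h\<^sub>j\<^sub>k v\<^sub>j (cnj v\<^sub>k)\<close>.\<close>

definition form_J :: "'n::finite form \<Rightarrow> complex^'n \<Rightarrow> complex" where
  "form_J \<alpha> v = \<alpha> (\<lambda>i. if i = 0 then v else \<i> *s v)"

definition semipositive_form :: "'n::finite form \<Rightarrow> bool" where
  "semipositive_form \<alpha> \<longleftrightarrow> (\<forall>v. form_J \<alpha> v \<in> \<real> \<and> Re (form_J \<alpha> v) \<ge> 0)"

definition positive_form :: "'n::finite form \<Rightarrow> bool" where
  "positive_form \<alpha> \<longleftrightarrow> (\<forall>v. v \<noteq> 0 \<longrightarrow> form_J \<alpha> v \<in> \<real> \<and> Re (form_J \<alpha> v) > 0)"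

section \<open>Differential forms on a manifold\<close>

text \<open>A differential form is given by its coordinate expressions: its value at a point,
  read in each chart around that point.\<close>

type_synonym ('a, 'n) dform = "('a, 'n) chart \<Rightarrow> 'a \<Rightarrow> 'n form"

definition dform_power :: "('a, 'n) dform \<Rightarrow> nat \<Rightarrow> ('a, 'n) dform" where
  "dform_power \<alpha> k = (\<lambda>\<kappa> p. wedge_power (\<alpha> \<kappa> p) k)"

definition dform_add :: "('a, 'n) dform \<Rightarrow> ('a, 'n) dform \<Rightarrow> ('a, 'n) dform" where
  "dform_add \<alpha> \<beta> = (\<lambda>\<kappa> p v. \<alpha> \<kappa> p v + \<beta> \<kappa> p v)"

text \<open>\<open>\<alpha> = f \<beta>\<close> at the point \<open>p\<close>, for a real factor \<open>f\<close>.\<close>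

definition dform_scaled_at ::
    "('a, 'n) chart set \<Rightarrow> 'a \<Rightarrow> ('a, 'n) dform \<Rightarrow> real \<Rightarrow> ('a, 'n) dform \<Rightarrow> bool" where
  "dform_scaled_at A p \<alpha> f \<beta> \<longleftrightarrow>
     (\<forall>\<kappa>\<in>A. p \<in> chart_dom \<kappa> \<longrightarrow> (\<forall>v. \<alpha> \<kappa> p v = complex_of_real f * \<beta> \<kappa> p v))"

text \<open>The quotient \<open>\<alpha> / \<beta>\<close> of forms of top degree, as a function on the manifold.\<close>

definition dform_quotient ::
    "('a, 'n) chart set \<Rightarrow> ('a, 'n) dform \<Rightarrow> ('a, 'n) dform \<Rightarrow> 'a \<Rightarrow> real" where
  "dform_quotient A \<alpha> \<beta> p = (THE f. dform_scaled_at A p \<alpha> f \<beta>)"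

section \<open>Hermitian metrics and the operator \<open>\<i> \<partial> \<partial>bar\<close>\<close>

text \<open>The metric is given by its coefficient matrices \<open>g \<kappa> p\<close>; its form is
  \<open>\<omega> = \<i> \<Sum> g\<^sub>j\<^sub>k dz\<^sub>j \<and> d\<zeta>\<^sub>k\<close>.\<close>

definition metric_form :: "(('a, 'n) chart \<Rightarrow> 'a \<Rightarrow> complex^'n^'n) \<Rightarrow> ('a, 'n::finite) dform" where
  "metric_form g = (\<lambda>\<kappa> p v. \<i> * form11 (g \<kappa> p) v)"

text \<open>The third condition says that the coefficients are smooth, the last one that the
  coordinate expressions of \<open>\<omega>\<close> are pulled back to each other by the transition maps.\<close>

definition hermitian_metric ::
    "('a, 'n::finite) chart set \<Rightarrow> (('a, 'n) chart \<Rightarrow> 'a \<Rightarrow> complex^'n^'n) \<Rightarrow> bool" where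
  "hermitian_metric A g \<longleftrightarrow>
     (\<forall>\<kappa>\<in>A. \<forall>p\<in>chart_dom \<kappa>. \<forall>j k. g \<kappa> p $ k $ j = cnj (g \<kappa> p $ j $ k)) \<and>
     (\<forall>\<kappa>\<in>A. \<forall>p\<in>chart_dom \<kappa>. positive_form (metric_form g \<kappa> p)) \<and>
     (\<forall>\<kappa>\<in>A. smooth_on (coord \<kappa> ` chart_dom \<kappa>) (\<lambda>z. g \<kappa> (chart_inv \<kappa> z))) \<and>
     (\<forall>\<kappa>\<in>A. \<forall>\<kappa>'\<in>A. \<forall>p\<in>chart_dom \<kappa> \<inter> chart_dom \<kappa>'. \<forall>v.
        metric_form g \<kappa> p v =
        metric_form g \<kappa>' p
          (\<lambda>i. frechet_derivative (transition \<kappa> \<kappa>') (at (coord \<kappa> p)) (v i)))"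

text \<open>The Wirtinger derivatives \<open>\<partial>/\<partial>z\<^sub>j\<close> and \<open>\<partial>/\<partial>(cnj z\<^sub>j)\<close>.\<close>

definition wirt :: "'n::finite \<Rightarrow> (complex^'n \<Rightarrow> complex) \<Rightarrow> complex^'n \<Rightarrow> complex" where
  "wirt j f z = (frechet_derivative f (at z) (axis j 1)
                 - \<i> * frechet_derivative f (at z) (axis j \<i>)) / 2"

definition wirt_bar :: "'n::finite \<Rightarrow> (complex^'n \<Rightarrow> complex) \<Rightarrow> complex^'n \<Rightarrow> complex" where
  "wirt_bar j f z = (frechet_derivative f (at z) (axis j 1)
                     + \<i> * frechet_derivative f (at z) (axis j \<i>)) / 2"

definition i_ddbar :: "('a \<Rightarrow> real) \<Rightarrow> ('a, 'n::finite) dform" where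
  "i_ddbar u = (\<lambda>\<kappa> p v. \<i> * form11 (\<chi> j k.
      wirt j (wirt_bar k (\<lambda>z. complex_of_real (u (chart_inv \<kappa> z)))) (coord \<kappa> p)) v)"

definition smooth_PSH ::
    "('a, 'n::finite) chart set \<Rightarrow> ('a, 'n) dform \<Rightarrow> ('a \<Rightarrow> real) set" where
  "smooth_PSH A \<omega> = {u. smooth_fun A u \<and>
     (\<forall>\<kappa>\<in>A. \<forall>p\<in>chart_dom \<kappa>. semipositive_form (dform_add \<omega> (i_ddbar u) \<kappa> p))}"

definition max_over :: "'a set \<Rightarrow> ('a \<Rightarrow> real) \<Rightarrow> real" where
  "max_over S f = (GREATEST m. m \<in> f ` S)"

end

theory Submission
  imports
    Defs
    "HOL-Complex_Analysis.Cauchy_Integral_Formula"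
    "HOL-Computational_Algebra.Fundamental_Theorem_Algebra"
begin

text \<open>The solution \<open>\<phi>\<close> makes the quotient constantly \<open>exp c\<close>.  For any competitor \<open>u\<close>, at a minimum
  point of \<open>u - \<phi>\<close> the complex Hessian of \<open>u - \<phi>\<close> is semidefinite, so there the form of \<open>u\<close>
  dominates that of \<open>\<phi>\<close>, and so do their top powers; hence the maximum of the quotient for \<open>u\<close>
  is at least \<open>exp c\<close>.  In coordinates a top power is a determinant times a fixed volume form.  That
  the quotient of top powers does not depend on the chart follows from the transformation of the
  Levi form under holomorphic coordinate changes.\<close>

section \<open>Top powers of (1,1)-forms\<close>

text \<open>Three features of the setting shape the work. \<open>dform_quotient\<close> is a
  \<open>THE\<close> over a factor that must be right in every chart at once, so existence
  (invariance under changes of charts) and uniqueness (a volume form with some nonzero value) both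
  have to be shown before any quotient can be computed. \<open>max_over\<close> is a
  \<open>GREATEST\<close>, so a maximum can be used only once it is known to be attained; this is
  where compactness and the continuity of the quotient enter. Competitors are only semipositive, so
  their matrices may degenerate; strict positivity is available on the side of \<phi> alone, where
  the equation makes the determinant nonzero. The comparison of determinants is then read off from
  the one-variable polynomial det (M + t P), whose values at t = 0 and t = 1 belong to \<phi> and to
  the competitor.\<close>

definition sesq :: "complex^'n^'n \<Rightarrow> complex^'n \<Rightarrow> complex^'n::finite \<Rightarrow> complex" where
  "sesq M x y = (\<Sum>j\<in>UNIV. \<Sum>k\<in>UNIV. M $ j $ k * x $ j * cnj (y $ k))"

lemma sum_permutes_lessThan_2:
  fixes f :: "(nat \<Rightarrow> nat) \<Rightarrow> 'b::comm_monoid_add"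
  shows "(\<Sum>\<sigma> | \<sigma> permutes {..<2}. f \<sigma>) = f id + f (Transposition.transpose 0 1)"
proof -
  have 2: "{..<2} = insert (1::nat) (insert 0 {})" by auto
  show ?thesis
    unfolding 2 by (simp add: sum_over_permutations_insert permutes_sing add.commute transpose_commute)
qed

lemma form11_eq_sesq:
  fixes M :: "complex^'n^'n::finite"
  shows "form11 M v = sesq M (v 0) (v 1) - sesq M (v 1) (v 0)"
proof -
  have "wedge 1 1 (dz j) (dzbar k) v = v 0 $ j * cnj (v 1 $ k) - v 1 $ j * cnj (v 0 $ k)" for j k
    unfolding wedge_def dz_def dzbar_def one_add_one
    by (subst sum_permutes_lessThan_2) (simp add: sign_swap_id)
  then show ?thesis
    unfolding form11_def sesq_def by (simp only:) (simp add: algebra_simps flip: sum_subtractf)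
qed

text \<open>The block permutation that fixes 0 and 1 and lets \<open>\<tau>\<close> act on the
  places from 2 on. In \<open>wedge_power \<alpha> (Suc k)\<close> the inner power permutes exactly
  those places.\<close>

definition shift2 :: "(nat \<Rightarrow> nat) \<Rightarrow> nat \<Rightarrow> nat" where
  "shift2 \<tau> m = (if m < 2 then m else 2 + \<tau> (m - 2))"

lemma shift2_permutes_sign:
  assumes "\<tau> permutes {..<m}"
  shows "shift2 \<tau> permutes {..<2 + m} \<and> sign (shift2 \<tau>) = sign \<tau>"
  using assms finite_lessThan
proof (induction rule: permutes_induct)
  case id
  have "shift2 id = id" by (auto simp: shift2_def fun_eq_iff)
  then show ?case by (simp add: permutes_id sign_id del: id_apply flip: id_def)
next
  case (swap a b p)
  have eq: "shift2 (Transposition.transpose a b \<circ> p) = Transposition.transpose (2 + a) (2 + b) \<circ> shift2 p"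
    by (auto simp: shift2_def fun_eq_iff Transposition.transpose_def)
  have t: "Transposition.transpose (2 + a) (2 + b) permutes {..<2 + m}"
    using swap by (intro permutes_swap_id) auto
  have "permutation p" "permutation (shift2 p)"
    using swap permutes_imp_permutation[of "{..<m}"] permutes_imp_permutation[of "{..<2 + m}"] by auto
  then show ?case
    using swap t unfolding eq
    by (simp add: permutes_compose sign_compose permutation_swap_id sign_swap_id del: o_apply)
qed

text \<open>In the induction step a permutation \<open>\<tau>\<close> of the inner power is absorbed
  into the outer sum by composing with \<open>shift2 \<tau>\<close>, so all \<open>\<tau>\<close>
  contribute equally. The two terms of \<open>\<alpha>\<close> give a factor 2 and there are
  \<open>fact (2 * k)\<close> choices of \<open>\<tau>\<close>; both cancel against the
  normalization in \<open>wedge\<close>, so no constant survives.\<close>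

lemma wedge_power_antisymmetrization:
  assumes \<alpha>: "\<And>v. \<alpha> v = b (v 0) (v 1) - b (v 1) (v 0)"
  shows "wedge_power \<alpha> k v =
    (\<Sum>\<sigma> | \<sigma> permutes {..<2 * k}. of_int (sign \<sigma>) * (\<Prod>i<k. b (v (\<sigma> (2 * i))) (v (\<sigma> (2 * i + 1)))))"
proof (induction k arbitrary: v)
  case 0
  then show ?case by (simp add: sign_id)
next
  case (Suc k)
  let ?S = "{..<2 + 2 * k}"
  define E where "E \<sigma> = b (v (\<sigma> 0)) (v (\<sigma> 1)) * (\<Prod>i<k. b (v (\<sigma> (2 + 2 * i))) (v (\<sigma> (3 + 2 * i))))"
    for \<sigma> :: "nat \<Rightarrow> nat"
  define G where "G = (\<Sum>\<sigma> | \<sigma> permutes ?S. of_int (sign \<sigma>) * E \<sigma>)"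
  have swap01: "Transposition.transpose 0 1 permutes ?S"
    by (intro permutes_swap_id) auto
  have reindex: "(\<Sum>\<sigma> | \<sigma> permutes ?S. of_int (sign \<sigma> * sign q) * E (\<sigma> \<circ> q)) = G"
    if q: "q permutes ?S" for q
  proof -
    have "G = (\<Sum>\<sigma> | \<sigma> permutes ?S. of_int (sign (\<sigma> \<circ> q)) * E (\<sigma> \<circ> q))"
      unfolding G_def by (rule sum_permutations_compose_right[OF q])
    also have "\<dots> = (\<Sum>\<sigma> | \<sigma> permutes ?S. of_int (sign \<sigma> * sign q) * E (\<sigma> \<circ> q))"
      using q by (intro sum.cong refl)
        (simp add: sign_compose permutes_imp_permutation[of ?S])
    finally show ?thesis by simp
  qed
  have inner: "(\<Sum>\<sigma> | \<sigma> permutes ?S. of_int (sign \<sigma>) * (b (v (\<sigma> 0)) (v (\<sigma> 1)) - b (v (\<sigma> 1)) (v (\<sigma> 0)))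
        * (of_int (sign \<tau>) * (\<Prod>i<k. b (v (\<sigma> (2 + \<tau> (2 * i)))) (v (\<sigma> (2 + \<tau> (2 * i + 1))))))) = 2 * G"
    if \<tau>: "\<tau> permutes {..<2 * k}" for \<tau>
  proof -
    define q where "q = shift2 \<tau>"
    have q: "q permutes ?S" "sign q = sign \<tau>"
      using shift2_permutes_sign[OF \<tau>] by (auto simp: q_def)
    \<comment> \<open>\<open>q\<close> accounts for the first term of \<open>\<alpha>\<close>. For
      the second term the first two places are exchanged as well, and the sign of this exchange
      turns the minus into a plus.\<close>
    let ?r = "q \<circ> Transposition.transpose 0 1"
    have r: "?r permutes ?S" "sign ?r = - sign \<tau>"
      using q swap01
      by (auto simp: permutes_compose sign_compose permutes_imp_permutation[of ?S] sign_swap_id)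
    have "of_int (sign \<sigma>) * (b (v (\<sigma> 0)) (v (\<sigma> 1)) - b (v (\<sigma> 1)) (v (\<sigma> 0)))
        * (of_int (sign \<tau>) * (\<Prod>i<k. b (v (\<sigma> (2 + \<tau> (2 * i)))) (v (\<sigma> (2 + \<tau> (2 * i + 1))))))
      = of_int (sign \<sigma> * sign q) * E (\<sigma> \<circ> q) + of_int (sign \<sigma> * sign ?r) * E (\<sigma> \<circ> ?r)" for \<sigma>
      unfolding q(2) r(2) E_def
      by (simp add: q_def shift2_def Transposition.transpose_def algebra_simps)
    then show ?thesis
      by (simp only: sum.distrib reindex[OF q(1)] reindex[OF r(1)]) simp
  qed
  have "wedge_power \<alpha> (Suc k) v = (\<Sum>\<tau> | \<tau> permutes {..<2 * k}. 2 * G) / (fact 2 * fact (2 * k))"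
    unfolding wedge_power.simps wedge_def Suc.IH \<alpha>
    by (subst sum.cong[OF refl inner[symmetric]], simp)
       (subst sum.swap, simp add: sum_distrib_left algebra_simps)
  also have "\<dots> = G"
    by (simp add: card_permutations fact_2)
  also have "G = (\<Sum>\<sigma> | \<sigma> permutes {..<2 * Suc k}. of_int (sign \<sigma>) *
      (\<Prod>i<Suc k. b (v (\<sigma> (2 * i))) (v (\<sigma> (2 * i + 1)))))"
    unfolding G_def E_def by (simp add: prod.lessThan_Suc_shift eval_nat_numeral del: prod.lessThan_Suc)
  finally show ?case .
qed

section \<open>Wedge products of one-forms as determinants\<close>

definition alt_prod :: "nat \<Rightarrow> (nat \<Rightarrow> 'v \<Rightarrow> complex) \<Rightarrow> (nat \<Rightarrow> 'v) \<Rightarrow> complex" where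
  "alt_prod m c v = (\<Sum>\<sigma> | \<sigma> permutes {..<m}. of_int (sign \<sigma>) * (\<Prod>i<m. c i (v (\<sigma> i))))"

lemma alt_prod_cong:
  "(\<And>i. i < m \<Longrightarrow> c i = c' i) \<Longrightarrow> alt_prod m c v = alt_prod m c' v"
  unfolding alt_prod_def by simp

lemma alt_prod_permute:
  assumes q: "q permutes {..<m}"
  shows "alt_prod m (c \<circ> q) v = of_int (sign q) * alt_prod m c v"
proof -
  have "alt_prod m (c \<circ> q) v =
      (\<Sum>\<sigma> | \<sigma> permutes {..<m}. of_int (sign (\<sigma> \<circ> q)) * (\<Prod>i<m. c (q i) (v (\<sigma> (q i)))))"
    unfolding alt_prod_def
    by (subst sum_permutations_compose_right[OF q]) simp
  also have "\<dots> = (\<Sum>\<sigma> | \<sigma> permutes {..<m}. of_int (sign q) * (of_int (sign \<sigma>) * (\<Prod>i<m. c i (v (\<sigma> i)))))"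
  proof (intro sum.cong refl, clarify)
    fix \<sigma> assume "\<sigma> permutes {..<m}"
    then have "sign (\<sigma> \<circ> q) = sign \<sigma> * sign q"
      using q by (simp add: sign_compose permutes_imp_permutation[of "{..<m}"])
    moreover have "(\<Prod>i<m. c (q i) (v (\<sigma> (q i)))) = (\<Prod>i<m. c i (v (\<sigma> i)))"
      using prod.permute[OF q, of "\<lambda>i. c i (v (\<sigma> i))"] by (simp add: o_def)
    ultimately show "of_int (sign (\<sigma> \<circ> q)) * (\<Prod>i<m. c (q i) (v (\<sigma> (q i)))) =
        of_int (sign q) * (of_int (sign \<sigma>) * (\<Prod>i<m. c i (v (\<sigma> i))))"
      by simp
  qed
  finally show ?thesis
    by (simp add: alt_prod_def sum_distrib_left)
qed

text \<open>Invariance of a determinant under transposition. In this form each factor involves one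
  fixed \<open>v i\<close>, as needed when the slots are expanded independently of each
  other.\<close>

lemma alt_prod_transpose:
  "alt_prod m c v = (\<Sum>\<sigma> | \<sigma> permutes {..<m}. of_int (sign \<sigma>) * (\<Prod>i<m. c (\<sigma> i) (v i)))"
proof -
  have "alt_prod m c v =
      (\<Sum>\<sigma> | \<sigma> permutes {..<m}. of_int (sign (inv \<sigma>)) * (\<Prod>i<m. c i (v (inv \<sigma> i))))"
    unfolding alt_prod_def by (subst sum_permutations_inverse) simp
  also have "\<dots> = (\<Sum>\<sigma> | \<sigma> permutes {..<m}. of_int (sign \<sigma>) * (\<Prod>i<m. c (\<sigma> i) (v i)))"
  proof (intro sum.cong refl, clarify)
    fix \<sigma> assume s: "\<sigma> permutes {..<m}"
    have "(\<Prod>i<m. c i (v (inv \<sigma> i))) = (\<Prod>i<m. c (\<sigma> i) (v i))"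
      using prod.permute[OF s, of "\<lambda>i. c i (v (inv \<sigma> i))"] s
      by (simp add: o_def permutes_inverses)
    then show "of_int (sign (inv \<sigma>)) * (\<Prod>i<m. c i (v (inv \<sigma> i))) =
        of_int (sign \<sigma>) * (\<Prod>i<m. c (\<sigma> i) (v i))"
      using s by (simp add: sign_inverse permutes_imp_permutation[of "{..<m}"])
  qed
  finally show ?thesis .
qed

text \<open>The factors at the even positions are coordinates \<open>z\<^sub>J\<close>, those at the odd positions are
  conjugate coordinates \<open>cnj z\<^sub>K\<close>, as in \<open>dz \<and> d\<zeta> \<and> dz \<and> d\<zeta> \<and> \<dots>\<close>.\<close>

definition zzbar :: "(nat \<Rightarrow> 'n) \<Rightarrow> (nat \<Rightarrow> 'n) \<Rightarrow> nat \<Rightarrow> complex^'n::finite \<Rightarrow> complex" where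
  "zzbar J K i w = (if even i then w $ J (i div 2) else cnj (w $ K (i div 2)))"

definition top_form :: "(nat \<Rightarrow> 'n) \<Rightarrow> (nat \<Rightarrow> 'n) \<Rightarrow> (nat \<Rightarrow> complex^'n::finite) \<Rightarrow> complex" where
  "top_form J K = alt_prod (2 * CARD('n)) (zzbar J K)"

lemma prod_lessThan_double:
  fixes h :: "nat \<Rightarrow> 'b::comm_monoid_mult"
  shows "(\<Prod>i<2 * n. h i) = (\<Prod>i<n. h (2 * i) * h (2 * i + 1))"
  by (induction n) (simp_all add: mult.assoc)

lemma top_form_cong:
  fixes J K J' K' :: "nat \<Rightarrow> 'n::finite"
  assumes "\<And>i. i < CARD('n) \<Longrightarrow> J i = J' i" "\<And>i. i < CARD('n) \<Longrightarrow> K i = K' i"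
  shows "top_form J K v = top_form J' K' v"
  unfolding top_form_def by (intro alt_prod_cong) (auto simp: zzbar_def fun_eq_iff assms)

text \<open>Entry \<open>a\<close> of \<open>J\<close> sits in the even slot \<open>2 * a\<close>
  and entry \<open>a\<close> of \<open>K\<close> in the odd slot \<open>2 * a + 1\<close>, so
  swapping two entries of one list is a single transposition of one-forms.\<close>

lemma
  fixes J K :: "nat \<Rightarrow> 'n::finite"
  assumes ab: "a < CARD('n)" "b < CARD('n)" "a \<noteq> b"
  shows top_form_swap_left: "top_form (J \<circ> Transposition.transpose a b) K v = - top_form J K v"
    and top_form_swap_right: "top_form J (K \<circ> Transposition.transpose a b) v = - top_form J K v"
proof -
  let ?m = "2 * CARD('n)"
  have e: "zzbar (J \<circ> Transposition.transpose a b) K = zzbar J K \<circ> Transposition.transpose (2 * a) (2 * b)"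
    by (rule ext)+ (auto simp: zzbar_def Transposition.transpose_def elim!: evenE)
  have o: "zzbar J (K \<circ> Transposition.transpose a b) = zzbar J K \<circ> Transposition.transpose (2 * a + 1) (2 * b + 1)"
    by (rule ext)+ (auto simp: zzbar_def Transposition.transpose_def elim!: oddE)
  have "Transposition.transpose (2 * a) (2 * b) permutes {..<?m}"
    using ab by (intro permutes_swap_id) auto
  from alt_prod_permute[OF this] ab
  show "top_form (J \<circ> Transposition.transpose a b) K v = - top_form J K v"
    unfolding top_form_def e by (simp add: sign_swap_id)
  have "Transposition.transpose (2 * a + 1) (2 * b + 1) permutes {..<?m}"
    using ab by (intro permutes_swap_id) auto
  from alt_prod_permute[OF this] ab
  show "top_form J (K \<circ> Transposition.transpose a b) v = - top_form J K v"
    unfolding top_form_def o by (simp add: sign_swap_id)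
qed

text \<open>A repeated index yields a transposition that fixes the list, so the value equals its own
  negative.\<close>

lemma top_form_eq_0:
  fixes J K :: "nat \<Rightarrow> 'n::finite"
  assumes "\<not> inj_on J {..<CARD('n)} \<or> \<not> inj_on K {..<CARD('n)}"
  shows "top_form J K v = 0"
  using assms
proof
  assume "\<not> inj_on J {..<CARD('n)}"
  then obtain a b where ab: "a < CARD('n)" "b < CARD('n)" "a \<noteq> b" and "J a = J b"
    by (auto simp: inj_on_def)
  then have "J \<circ> Transposition.transpose a b = J"
    by (auto simp: fun_eq_iff Transposition.transpose_def)
  then have "top_form J K v = - top_form J K v"
    using top_form_swap_left[OF ab, of J K v] by simp
  then show ?thesis by simp
next
  assume "\<not> inj_on K {..<CARD('n)}"
  then obtain a b where ab: "a < CARD('n)" "b < CARD('n)" "a \<noteq> b" and "K a = K b"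
    by (auto simp: inj_on_def)
  then have "K \<circ> Transposition.transpose a b = K"
    by (auto simp: fun_eq_iff Transposition.transpose_def)
  then have "top_form J K v = - top_form J K v"
    using top_form_swap_right[OF ab, of J K v] by simp
  then show ?thesis by simp
qed

text \<open>Turns a transposition of values in \<open>'n\<close> into a transposition of positions,
  so that permutations of \<open>'n\<close> can be treated one transposition at a time with the two
  swap rules for \<open>top_form\<close>.\<close>

lemma transpose_comp_inj:
  assumes K: "bij_betw K S UNIV" and "a \<noteq> b"
  obtains i j where "i \<in> S" "j \<in> S" "i \<noteq> j"
    "\<And>x. x \<in> S \<Longrightarrow> Transposition.transpose a b (K x) = (K \<circ> Transposition.transpose i j) x"
proof -
  obtain i j where ij: "i \<in> S" "j \<in> S" "K i = a" "K j = b"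
    using K by (metis UNIV_I bij_betw_iff_bijections)
  with \<open>a \<noteq> b\<close> K have "Transposition.transpose a b (K x) = (K \<circ> Transposition.transpose i j) x" if "x \<in> S" for x
    using that by (auto simp: Transposition.transpose_def bij_betw_def inj_on_def)
  with ij \<open>a \<noteq> b\<close> that show thesis by blast
qed

lemma bij_betw_permutes_comp:
  assumes "bij_betw K S UNIV" "p permutes UNIV"
  shows "bij_betw (p \<circ> K) S UNIV"
  using assms by (meson bij_betw_trans permutes_imp_bij)

lemma top_form_permute_left:
  fixes J K :: "nat \<Rightarrow> 'n::finite"
  assumes J: "bij_betw J {..<CARD('n)} UNIV" and "p permutes UNIV"
  shows "top_form (p \<circ> J) K v = of_int (sign p) * top_form J K v"
  using assms(2) finite
proof (induction rule: permutes_induct)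
  case id
  then show ?case by (simp add: sign_id)
next
  case (swap a b p)
  obtain i j where ij: "i < CARD('n)" "j < CARD('n)" "i \<noteq> j"
    "\<And>x. x < CARD('n) \<Longrightarrow> Transposition.transpose a b ((p \<circ> J) x) = (p \<circ> J \<circ> Transposition.transpose i j) x"
    using transpose_comp_inj[OF bij_betw_permutes_comp[OF J \<open>p permutes UNIV\<close>] \<open>a \<noteq> b\<close>]
    by (metis lessThan_iff)
  have "top_form (Transposition.transpose a b \<circ> p \<circ> J) K v = top_form (p \<circ> J \<circ> Transposition.transpose i j) K v"
    using ij(4) by (intro top_form_cong) auto
  also have "\<dots> = - top_form (p \<circ> J) K v"
    using top_form_swap_left[OF ij(1-3)] .
  finally show ?case
    using swap
    by (simp add: sign_compose permutes_imp_permutation[of UNIV] permutation_swap_id sign_swap_id del: o_apply)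
qed

lemma top_form_permute_right:
  fixes J K :: "nat \<Rightarrow> 'n::finite"
  assumes K: "bij_betw K {..<CARD('n)} UNIV" and "p permutes UNIV"
  shows "top_form J (p \<circ> K) v = of_int (sign p) * top_form J K v"
  using assms(2) finite
proof (induction rule: permutes_induct)
  case id
  then show ?case by (simp add: sign_id)
next
  case (swap a b p)
  obtain i j where ij: "i < CARD('n)" "j < CARD('n)" "i \<noteq> j"
    "\<And>x. x < CARD('n) \<Longrightarrow> Transposition.transpose a b ((p \<circ> K) x) = (p \<circ> K \<circ> Transposition.transpose i j) x"
    using transpose_comp_inj[OF bij_betw_permutes_comp[OF K \<open>p permutes UNIV\<close>] \<open>a \<noteq> b\<close>]
    by (metis lessThan_iff)
  have "top_form J (Transposition.transpose a b \<circ> p \<circ> K) v = top_form J (p \<circ> K \<circ> Transposition.transpose i j) v"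
    using ij(4) by (intro top_form_cong) auto
  also have "\<dots> = - top_form J (p \<circ> K) v"
    using top_form_swap_right[OF ij(1-3)] .
  finally show ?case
    using swap
    by (simp add: sign_compose permutes_imp_permutation[of UNIV] permutation_swap_id sign_swap_id del: o_apply)
qed

lemma bij_betw_lessThan_CARD:
  fixes K :: "nat \<Rightarrow> 'n::finite"
  assumes "inj_on K {..<CARD('n)}"
  shows "bij_betw K {..<CARD('n)} UNIV"
proof -
  have "card (K ` {..<CARD('n)}) = CARD('n)" using assms by (simp add: card_image)
  then have "K ` {..<CARD('n)} = UNIV" by (intro card_subset_eq) auto
  with assms show ?thesis by (simp add: bij_betw_def)
qed

text \<open>Lists \<open>K\<close> with a repetition contribute nothing. Every other
  \<open>K\<close> is \<open>\<rho> \<circ> J\<close> on the index range for exactly one permutation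
  \<open>\<rho>\<close>, and moving its conjugate factors into the order of \<open>J\<close> costs
  \<open>sign \<rho>\<close>; what remains is the Leibniz expansion of \<open>det M\<close>.\<close>

lemma sum_PiE_top_form:
  fixes M :: "complex^'n^'n::finite" and J :: "nat \<Rightarrow> 'n"
  assumes J: "bij_betw J {..<CARD('n)} UNIV"
  shows "(\<Sum>K\<in>{..<CARD('n)} \<rightarrow>\<^sub>E UNIV. (\<Prod>i<CARD('n). M $ J i $ K i) * top_form J K v) = det M * top_form J J v"
proof -
  let ?I = "{..<CARD('n)}"
  let ?g = "inv_into ?I J"
  have Jg: "J (?g j) = j" "?g j \<in> ?I" for j
    using J bij_betw_apply[OF bij_betw_inv_into[OF J]] by (auto simp: bij_betw_def f_inv_into_f)
  have gJ: "?g (J i) = i" if "i \<in> ?I" for i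
    using J that by (auto simp: bij_betw_def)
  have "(\<Sum>K\<in>?I \<rightarrow>\<^sub>E UNIV. (\<Prod>i<CARD('n). M $ J i $ K i) * top_form J K v) =
    (\<Sum>K\<in>{K \<in> ?I \<rightarrow>\<^sub>E UNIV. inj_on K ?I}. (\<Prod>i<CARD('n). M $ J i $ K i) * top_form J K v)"
    by (intro sum.mono_neutral_right) (auto simp: top_form_eq_0 intro: finite_PiE)
  also have "\<dots> = (\<Sum>\<rho> | \<rho> permutes UNIV. of_int (sign \<rho>) * (\<Prod>j\<in>UNIV. M $ j $ \<rho> j) * top_form J J v)"
  proof (rule sum.reindex_bij_witness[where j = "\<lambda>K. K \<circ> ?g" and i = "\<lambda>\<rho>. restrict (\<rho> \<circ> J) ?I"])
    fix K :: "nat \<Rightarrow> 'n" assume K: "K \<in> {K \<in> ?I \<rightarrow>\<^sub>E UNIV. inj_on K ?I}"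
    show "restrict (K \<circ> ?g \<circ> J) ?I = K"
      using K by (auto simp: fun_eq_iff gJ PiE_def extensional_def)
    have "bij_betw (K \<circ> ?g) UNIV UNIV"
      using K by (auto intro: bij_betw_trans[OF bij_betw_inv_into[OF J] bij_betw_lessThan_CARD[of K]] simp del: o_apply)
    then show \<rho>: "K \<circ> ?g \<in> {\<rho>. \<rho> permutes UNIV}"
      by (auto intro: bij_imp_permutes)
    have K_eq: "K i = (K \<circ> ?g \<circ> J) i" if "i < CARD('n)" for i
      using that by (simp add: gJ)
    have "(\<Prod>j\<in>UNIV. M $ j $ (K \<circ> ?g) j) = (\<Prod>i<CARD('n). M $ J i $ K i)"
      using prod.reindex_bij_betw[OF J, of "\<lambda>j. M $ j $ (K \<circ> ?g) j"]
      by (simp add: gJ)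
    moreover have "top_form J K v = of_int (sign (K \<circ> ?g)) * top_form J J v"
      using \<rho> K_eq top_form_permute_right[OF J, of "K \<circ> ?g" J v]
        top_form_cong[of J J K "K \<circ> ?g \<circ> J" v] by (simp del: o_apply)
    ultimately show "of_int (sign (K \<circ> ?g)) * (\<Prod>j\<in>UNIV. M $ j $ (K \<circ> ?g) j) * top_form J J v =
        (\<Prod>i<CARD('n). M $ J i $ K i) * top_form J K v"
      by (simp del: o_apply)
  next
    fix \<rho> assume "\<rho> \<in> {\<rho>::'n \<Rightarrow> 'n. \<rho> permutes UNIV}"
    then have \<rho>: "\<rho> permutes UNIV" by simp
    show "restrict (\<rho> \<circ> J) ?I \<circ> ?g = \<rho>"
      using Jg by (auto simp: fun_eq_iff)
    have "inj_on (\<rho> \<circ> J) ?I"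
      using bij_betw_permutes_comp[OF J \<rho>] by (rule bij_betw_imp_inj_on)
    then show "restrict (\<rho> \<circ> J) ?I \<in> {K \<in> ?I \<rightarrow>\<^sub>E UNIV. inj_on K ?I}"
      by (auto simp: inj_on_def)
  qed
  also have "\<dots> = det M * top_form J J v"
    unfolding det_def by (simp add: sum_distrib_right)
  finally show ?thesis .
qed

text \<open>All summands are equal, so this is n! times dz1 \<and> dzbar1 \<and> ... \<and> dzn
  \<and> dzbarn. The sum over all orderings \<open>J\<close> arises directly from the expansion of
  the top power and avoids the choice of an enumeration of \<open>'n\<close>.\<close>

definition volume_form :: "(nat \<Rightarrow> complex^'n::finite) \<Rightarrow> complex" where
  "volume_form v = (\<Sum>J\<in>{J \<in> {..<CARD('n)} \<rightarrow>\<^sub>E UNIV. inj_on J {..<CARD('n)}}. top_form J J v)"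

text \<open>The product of n values of \<open>sesq M\<close> expands over lists \<open>J\<close> and
  \<open>K\<close> of row and column indices. Antisymmetrizing a single monomial gives a
  \<open>top_form\<close>, and for each injective \<open>J\<close> the sum over \<open>K\<close> is
  a determinant. The scalar \<open>a\<close> is there for the \<i> in front of all forms considered
  later.\<close>

lemma wedge_power_form11:
  fixes M :: "complex^'n^'n::finite"
  shows "wedge_power (\<lambda>v. a * form11 M v) CARD('n) v = a ^ CARD('n) * det M * volume_form v"
proof -
  let ?n = "CARD('n)" and ?I = "{..<CARD('n)}"
  have sesq: "sesq M x y = (\<Sum>j\<in>UNIV. x $ j * (\<Sum>k\<in>UNIV. M $ j $ k * cnj (y $ k)))" for x y
    by (simp add: sesq_def sum_distrib_left algebra_simps)
  have expand: "(\<Prod>i<?n. sesq M (x i) (y i)) = (\<Sum>J\<in>?I \<rightarrow>\<^sub>E UNIV. \<Sum>K\<in>?I \<rightarrow>\<^sub>E UNIV.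
      (\<Prod>i<?n. M $ J i $ K i) * (\<Prod>i<?n. x i $ J i * cnj (y i $ K i)))" for x y :: "nat \<Rightarrow> complex^'n"
    unfolding sesq
    by (subst prod_sum_PiE)
       (simp_all add: prod.distrib prod_sum_PiE sum_distrib_left algebra_simps)
  have pairs: "(\<Prod>i<?n. w (2 * i) $ J i * cnj (w (2 * i + 1) $ K i)) = (\<Prod>i<2 * ?n. zzbar J K i (w i))"
    for w :: "nat \<Rightarrow> complex^'n" and J K
    unfolding prod_lessThan_double by (simp add: zzbar_def)
  have prod_sesq: "(\<Prod>i<?n. a * sesq M (w (2 * i)) (w (2 * i + 1))) = a ^ ?n *
      (\<Sum>J\<in>?I \<rightarrow>\<^sub>E UNIV. \<Sum>K\<in>?I \<rightarrow>\<^sub>E UNIV. (\<Prod>i<?n. M $ J i $ K i) * (\<Prod>i<2 * ?n. zzbar J K i (w i)))" for w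
    unfolding pairs[symmetric] expand[symmetric] by (simp add: prod.distrib)
  have "wedge_power (\<lambda>v. a * form11 M v) ?n v =
    (\<Sum>\<sigma> | \<sigma> permutes {..<2 * ?n}. of_int (sign \<sigma>) * (\<Prod>i<?n. a * sesq M (v (\<sigma> (2 * i))) (v (\<sigma> (2 * i + 1)))))"
    by (rule wedge_power_antisymmetrization[where b = "\<lambda>x y. a * sesq M x y"])
       (simp add: form11_eq_sesq algebra_simps)
  also have "\<dots> = a ^ ?n * (\<Sum>\<sigma> | \<sigma> permutes {..<2 * ?n}. \<Sum>J\<in>?I \<rightarrow>\<^sub>E UNIV. \<Sum>K\<in>?I \<rightarrow>\<^sub>E UNIV.
      (\<Prod>i<?n. M $ J i $ K i) * (of_int (sign \<sigma>) * (\<Prod>i<2 * ?n. zzbar J K i (v (\<sigma> i)))))"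
    by (simp only: prod_sesq[of "\<lambda>i. v (\<sigma> i)" for \<sigma>] sum_distrib_left mult.assoc mult.left_commute)
  also have "(\<Sum>\<sigma> | \<sigma> permutes {..<2 * ?n}. \<Sum>J\<in>?I \<rightarrow>\<^sub>E UNIV. \<Sum>K\<in>?I \<rightarrow>\<^sub>E UNIV.
      (\<Prod>i<?n. M $ J i $ K i) * (of_int (sign \<sigma>) * (\<Prod>i<2 * ?n. zzbar J K i (v (\<sigma> i))))) =
    (\<Sum>J\<in>?I \<rightarrow>\<^sub>E UNIV. \<Sum>K\<in>?I \<rightarrow>\<^sub>E UNIV. (\<Prod>i<?n. M $ J i $ K i) * top_form J K v)"
    unfolding top_form_def alt_prod_def sum_distrib_left
    by (subst sum.swap, rule sum.cong[OF refl], rule sum.swap)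
  also have "\<dots> = (\<Sum>J\<in>{J \<in> ?I \<rightarrow>\<^sub>E UNIV. inj_on J ?I}. \<Sum>K\<in>?I \<rightarrow>\<^sub>E UNIV.
      (\<Prod>i<?n. M $ J i $ K i) * top_form J K v)"
    by (intro sum.mono_neutral_right) (auto simp: top_form_eq_0 intro: finite_PiE)
  also have "\<dots> = det M * volume_form v"
    unfolding volume_form_def sum_distrib_left
    by (intro sum.cong refl sum_PiE_top_form bij_betw_lessThan_CARD) auto
  finally show ?thesis by (simp add: mult.assoc)
qed

text \<open>The same permutation acts on the dz factors and on the dzbar factors, so its sign
  appears squared.\<close>

lemma top_form_diag_eq:
  fixes J e :: "nat \<Rightarrow> 'n::finite"
  assumes J: "bij_betw J {..<CARD('n)} UNIV" and e: "bij_betw e {..<CARD('n)} UNIV"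
  shows "top_form J J v = top_form e e v"
proof -
  let ?g = "inv_into {..<CARD('n)} e"
  let ?p = "J \<circ> ?g"
  have "bij_betw ?p UNIV UNIV"
    using bij_betw_inv_into[OF e] J by (rule bij_betw_trans)
  then have p: "?p permutes UNIV" by (auto intro: bij_imp_permutes)
  have "top_form J J v = top_form (?p \<circ> e) (?p \<circ> e) v"
    using e by (intro top_form_cong) (auto simp: bij_betw_def)
  also have "\<dots> = of_int (sign ?p * sign ?p) * top_form e e v"
    using top_form_permute_left[OF e p, of "?p \<circ> e" v] top_form_permute_right[OF e p, of e v]
    by (simp del: o_apply sign_idempotent)
  finally show ?thesis by simp
qed

text \<open>In the complexified tangent space the vectors \<open>x \<mp> \<i> (\<i> x)\<close>, with \<open>x\<close> a coordinate
  vector, form (up to a factor 2) the basis dual to the \<open>z\<^sub>j\<close> and \<open>cnj z\<^sub>j\<close>; expanding the value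
  of the form on that basis gives real vectors on which it does not vanish.\<close>

lemma top_form_nonzero:
  fixes e :: "nat \<Rightarrow> 'n::finite"
  assumes e: "bij_betw e {..<CARD('n)} UNIV"
  shows "\<exists>v. top_form e e v \<noteq> 0"
proof (rule ccontr)
  assume "\<not> ?thesis"
  then have zero: "top_form e e v = 0" for v by simp
  let ?m = "2 * CARD('n)" and ?I = "{..<2 * CARD('n)}"
  let ?P = "{\<sigma>. \<sigma> permutes ?I}"
  define c where "c i b = (if b then 1 else if even i then - \<i> else \<i>)" for i :: nat and b
  define w where "w i b = (axis (e (i div 2)) (if b then 1 else \<i>) :: complex^'n)" for i :: nat and b
  have dual: "(\<Sum>b\<in>UNIV. c i b * zzbar e e j (w i b)) = (if i = j then 2 else 0)"
    if "i \<in> ?I" "j \<in> ?I" for i j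
  proof -
    have "e (i div 2) = e (j div 2) \<longleftrightarrow> i div 2 = j div 2"
      using e that by (auto simp: bij_betw_def inj_on_eq_iff)
    moreover have "i = j \<longleftrightarrow> i div 2 = j div 2 \<and> (even i \<longleftrightarrow> even j)"
      by (metis even_two_times_div_two odd_two_times_div_two_succ)
    ultimately show ?thesis
      by (auto simp: UNIV_bool c_def w_def zzbar_def axis_def)
  qed
  \<comment> \<open>Slot \<open>i\<close> receives the combination of \<open>w i True\<close> and
    \<open>w i False\<close> with coefficients \<open>c i\<close>. Multilinear expansion turns the
    sum into the determinant of the matrix in \<open>dual\<close>, which is twice the identity; its
    value contradicts the vanishing on real vectors.\<close>
  have "0 = (\<Sum>s\<in>?I \<rightarrow>\<^sub>E UNIV. (\<Prod>i<?m. c i (s i)) * top_form e e (\<lambda>i. w i (s i)))"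
    by (simp add: zero)
  also have "\<dots> = (\<Sum>\<sigma>\<in>?P. of_int (sign \<sigma>) *
      (\<Sum>s\<in>?I \<rightarrow>\<^sub>E UNIV. \<Prod>i<?m. c i (s i) * zzbar e e (\<sigma> i) (w i (s i))))"
    unfolding top_form_def alt_prod_transpose sum_distrib_left
    by (subst sum.swap) (simp add: prod.distrib algebra_simps)
  also have "\<dots> = (\<Sum>\<sigma>\<in>?P. of_int (sign \<sigma>) * (\<Prod>i<?m. \<Sum>b\<in>UNIV. c i b * zzbar e e (\<sigma> i) (w i b)))"
    by (simp add: prod_sum_PiE)
  also have "\<dots> = (\<Sum>\<sigma>\<in>?P. if \<sigma> = id then 2 ^ ?m else 0)"
  proof (intro sum.cong refl)
    fix \<sigma> assume "\<sigma> \<in> ?P"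
    then have \<sigma>: "\<sigma> permutes ?I" by simp
    then have "(\<Prod>i<?m. \<Sum>b\<in>UNIV. c i b * zzbar e e (\<sigma> i) (w i b)) = (\<Prod>i<?m. if i = \<sigma> i then 2 else 0)"
      by (intro prod.cong refl dual) (auto dest: permutes_in_image)
    also have "\<dots> = (if \<sigma> = id then 2 ^ ?m else 0)"
    proof (cases "\<sigma> = id")
      case False
      then obtain i where "\<sigma> i \<noteq> i" by (auto simp: fun_eq_iff)
      moreover from this have "i \<in> ?I" using \<sigma> by (auto dest: permutes_not_in)
      ultimately show ?thesis using False by (auto intro!: bexI[of _ i])
    qed simp
    finally show "of_int (sign \<sigma>) * (\<Prod>i<?m. \<Sum>b\<in>UNIV. c i b * zzbar e e (\<sigma> i) (w i b)) =
        (if \<sigma> = id then 2 ^ ?m else 0)"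
      by (auto simp: sign_id)
  qed
  also have "\<dots> = 2 ^ ?m"
    by (simp add: finite_permutations permutes_id)
  finally show False by simp
qed

text \<open>This lets the scalar factor between two top powers be recovered by evaluation on one
  tuple of vectors, hence makes the \<open>THE\<close> in \<open>dform_quotient\<close>
  unique.\<close>

lemma volume_form_nonzero: "\<exists>v :: nat \<Rightarrow> complex^'n::finite. volume_form v \<noteq> 0"
proof -
  let ?I = "{..<CARD('n)}" and ?S = "{J \<in> {..<CARD('n)} \<rightarrow>\<^sub>E UNIV. inj_on J {..<CARD('n)}} :: (nat \<Rightarrow> 'n) set"
  obtain e :: "nat \<Rightarrow> 'n" where e: "bij_betw e ?I UNIV"
    using ex_bij_betw_nat_finite[of "UNIV :: 'n set"] by (auto simp: atLeast0LessThan)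
  obtain v where v: "top_form e e v \<noteq> 0"
    using top_form_nonzero[OF e] by blast
  have "volume_form v = (\<Sum>J\<in>?S. top_form e e v)"
    unfolding volume_form_def
    by (intro sum.cong refl top_form_diag_eq[OF bij_betw_lessThan_CARD e]) auto
  then have vol: "volume_form v = of_nat (card ?S) * top_form e e v" by simp
  have "restrict e ?I \<in> ?S"
    using e by (auto simp: bij_betw_def inj_on_def)
  then have "?S \<noteq> {}" by blast
  moreover have "finite ?S"
    by (rule finite_subset[of _ "?I \<rightarrow>\<^sub>E UNIV"]) (auto intro: finite_PiE)
  ultimately have "card ?S \<noteq> 0"
    by (simp only: card_0_eq not_False_eq_True)
  with vol v have "volume_form v \<noteq> 0" by simp
  then show ?thesis by blast
qed

section \<open>Sesquilinear forms and determinants\<close>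

lemma sesq_add_matrix: "sesq (M + N) x y = sesq M x y + sesq N x y"
  and sesq_scale_matrix: "sesq (\<chi> j k. a * M $ j $ k) x y = a * sesq M x y"
  by (simp_all add: sesq_def algebra_simps sum.distrib sum_distrib_left)

lemma sesq_add: "sesq M (x + x') y = sesq M x y + sesq M x' y" "sesq M x (y + y') = sesq M x y + sesq M x y'"
  and sesq_scale: "sesq M (a *s x) y = a * sesq M x y" "sesq M x (a *s y) = cnj a * sesq M x y"
  by (simp_all add: sesq_def algebra_simps sum.distrib sum_distrib_left)

lemma sesq_axis: "sesq M (axis j 1) (axis k 1) = M $ j $ k"
proof -
  have "M $ j' $ k' * axis j 1 $ j' * cnj (axis k 1 $ k') = (if k' = k then if j' = j then M $ j $ k else 0 else 0)"
    for j' k' by (simp add: axis_def)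
  then show ?thesis by (simp add: sesq_def sum.delta)
qed

lemma sesq_eq_matrix_vector: "sesq M x y = (\<Sum>j\<in>UNIV. x $ j * (M *v (\<chi> i. cnj (y $ i))) $ j)"
  by (simp add: sesq_def matrix_vector_mult_def sum_distrib_left algebra_simps)

text \<open>In \<open>sesq\<close> the matrix acts on the conjugated second argument, which is why
  kernel vectors enter with a conjugation here and below.\<close>

lemma sesq_mult_vec_0:
  assumes "M *v x = 0"
  shows "sesq M y (\<chi> i. cnj (x $ i)) = 0"
  using assms by (simp add: sesq_eq_matrix_vector vec_lambda_eta)

lemma sesq_polarization:
  "4 * sesq M x y = sesq M (x + y) (x + y) - sesq M (x + (-1) *s y) (x + (-1) *s y)
    + \<i> * sesq M (x + \<i> *s y) (x + \<i> *s y) - \<i> * sesq M (x + (-\<i>) *s y) (x + (-\<i>) *s y)"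
  unfolding sesq_add sesq_scale by (simp add: algebra_simps)

text \<open>Over the complex numbers polarization recovers a sesquilinear form from its diagonal.
  Matrix identities thus follow from information about \<open>form_J\<close>, which sees only the
  diagonal.\<close>

lemma matrix_eq_of_sesq_diag:
  assumes "\<And>v. sesq M v v = sesq N v v"
  shows "M = N"
proof -
  have "4 * sesq M x y = 4 * sesq N x y" for x y
    unfolding sesq_polarization assms ..
  then have "sesq M x y = sesq N x y" for x y by simp
  then have "M $ j $ k = N $ j $ k" for j k
    using sesq_axis[of M j k] sesq_axis[of N j k] by simp
  then show ?thesis by (simp add: vec_eq_iff)
qed

lemma sesq_congruence:
  "sesq (transpose J ** M ** map_matrix cnj J) x y = sesq M (J *v x) (J *v y)"
proof -
  define w where "w = M *v (\<chi> i. cnj ((J *v y) $ i))"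
  have "map_matrix cnj J *v (\<chi> i. cnj (y $ i)) = (\<chi> i. cnj ((J *v y) $ i))"
    by (simp add: matrix_vector_mult_def map_matrix_def vec_eq_iff)
  then have "sesq (transpose J ** M ** map_matrix cnj J) x y = (\<Sum>j\<in>UNIV. x $ j * (transpose J *v w) $ j)"
    by (simp add: sesq_eq_matrix_vector w_def flip: matrix_vector_mul_assoc)
  also have "\<dots> = (\<Sum>j\<in>UNIV. \<Sum>a\<in>UNIV. J $ a $ j * x $ j * w $ a)"
    by (simp add: matrix_vector_mult_def transpose_def sum_distrib_left algebra_simps)
  also have "\<dots> = (\<Sum>a\<in>UNIV. \<Sum>j\<in>UNIV. J $ a $ j * x $ j * w $ a)"
    by (rule sum.swap)
  also have "\<dots> = sesq M (J *v x) (J *v y)"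
    unfolding sesq_eq_matrix_vector w_def[symmetric]
    by (simp add: matrix_vector_mult_def sum_distrib_right)
  finally show ?thesis .
qed

text \<open>Real diagonal values force \<open>M\<close> to equal its conjugate transpose, whose
  determinant is the conjugate of \<open>det M\<close>.\<close>

lemma det_hermitian_real:
  fixes M :: "complex^'n^'n::finite"
  assumes "\<And>v. sesq M v v \<in> \<real>"
  shows "det M \<in> \<real>"
proof -
  have "sesq (map_matrix cnj (transpose M)) v v = cnj (sesq M v v)" for v
  proof -
    have "cnj (sesq M v v) = (\<Sum>j\<in>UNIV. \<Sum>k\<in>UNIV. cnj (M $ j $ k) * v $ k * cnj (v $ j))"
      by (simp add: sesq_def algebra_simps)
    also have "\<dots> = (\<Sum>k\<in>UNIV. \<Sum>j\<in>UNIV. cnj (M $ j $ k) * v $ k * cnj (v $ j))"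
      by (rule sum.swap)
    finally show ?thesis
      by (simp add: sesq_def map_matrix_def transpose_def)
  qed
  then have "map_matrix cnj (transpose M) = M"
    using assms by (intro matrix_eq_of_sesq_diag) (simp add: Reals_cnj_iff)
  moreover have "det (map_matrix cnj (transpose M)) = cnj (det (transpose M))"
    by (simp add: det_def map_matrix_def)
  ultimately have "cnj (det M) = det M" by (simp add: det_transpose)
  then show ?thesis by (simp add: Reals_cnj_iff)
qed

lemma trivial_ker_iff_det:
  fixes M :: "complex^'n^'n::finite"
  shows "(\<forall>x. M *v x = 0 \<longrightarrow> x = 0) \<longleftrightarrow> det M \<noteq> 0"
  unfolding matrix_left_invertible_ker[symmetric] invertible_det_nz[symmetric] invertible_left_inverse ..

lemma det_nz_of_definite:
  assumes "\<And>v. v \<noteq> 0 \<Longrightarrow> sesq M v v \<noteq> 0"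
  shows "det M \<noteq> 0"
proof
  assume "det M = 0"
  then obtain x where x: "x \<noteq> 0" "M *v x = 0" using trivial_ker_iff_det[of M] by blast
  have "(\<chi> i. cnj (x $ i)) \<noteq> 0" using x(1) by (auto simp: vec_eq_iff)
  then show False using assms sesq_mult_vec_0[OF x(2)] by blast
qed

text \<open>By the Cauchy--Schwarz argument a null vector of a semidefinite form lies in its kernel.\<close>

lemma definite_of_semidefinite:
  assumes psd: "\<And>v. sesq M v v \<in> \<real> \<and> 0 \<le> Re (sesq M v v)" and det: "det M \<noteq> 0"
    and "v \<noteq> 0"
  shows "0 < Re (sesq M v v)"
proof (rule ccontr)
  assume "\<not> ?thesis"
  then have v0: "sesq M v v = 0"
    using psd[of v] by (auto simp: complex_eq_iff complex_is_Real_iff)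
  \<comment> \<open>Hermitian symmetry comes from conjugating the polarization identity, all of
    whose diagonal values are real.\<close>
  have herm: "cnj (sesq M y x) = sesq M x y" for x y
  proof -
    have r: "cnj (sesq M w w) = sesq M w w" for w using psd by (simp add: Reals_cnj_iff)
    have "4 * cnj (sesq M y x) = cnj (4 * sesq M y x)" by simp
    also have "\<dots> = sesq M (y + x) (y + x) - sesq M (y + (-1) *s x) (y + (-1) *s x)
      - \<i> * sesq M (y + \<i> *s x) (y + \<i> *s x) + \<i> * sesq M (y + (-\<i>) *s x) (y + (-\<i>) *s x)"
      unfolding sesq_polarization by (simp add: r)
    also have "\<dots> = 4 * sesq M x y" 
      unfolding sesq_add sesq_scale by (simp add: algebra_simps)
    finally show ?thesis by simp
  qed
  have "sesq M w v = 0" for w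
  proof (rule ccontr)
    assume nz: "sesq M w v \<noteq> 0"
    define b where "b = sesq M w v"
    define r where "r = Re (sesq M w w)"
    have ww: "sesq M w w = of_real r"
      using psd by (simp add: r_def of_real_Re)
    \<comment> \<open>Moving from \<open>w\<close> by the multiple \<open>a\<close> of the null
      vector \<open>v\<close> changes the value by \<open>- 2 * t * (cmod b)\<^sup>2\<close>, with
      no quadratic term. This \<open>t\<close> makes the result -1, which contradicts
      semidefiniteness.\<close>
    define t where "t = (r + 1) / (2 * (cmod b)\<^sup>2)"
    define a where "a = - (of_real t * b)"
    have "sesq M (w + a *s v) (w + a *s v) = of_real r + cnj a * b + a * cnj b"
      unfolding sesq_add sesq_scale using herm[of w v] by (simp add: v0 ww b_def)
    also have "\<dots> = of_real (r - 2 * t * (cmod b)\<^sup>2)"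
      by (simp add: a_def mult.assoc complex_norm_square del: of_real_power)
    also have "r - 2 * t * (cmod b)\<^sup>2 = - 1"
      using nz by (simp add: t_def b_def field_simps)
    finally have "Re (sesq M (w + a *s v) (w + a *s v)) = -1" by simp
    with psd[of "w + a *s v"] show False by simp
  qed
  then have "sesq M (axis j 1) v = 0" for j by blast
  moreover have "sesq M (axis j 1) v = (M *v (\<chi> i. cnj (v $ i))) $ j" for j
    by (simp add: sesq_eq_matrix_vector axis_def if_distrib[of "\<lambda>t. t * _"] cong: if_cong)
  ultimately have "M *v (\<chi> i. cnj (v $ i)) = 0" by (simp add: vec_eq_iff)
  moreover have "(\<chi> i. cnj (v $ i)) \<noteq> 0" using \<open>v \<noteq> 0\<close> by (auto simp: vec_eq_iff)
  moreover have "\<forall>x. M *v x = 0 \<longrightarrow> x = 0"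
    using det by (simp only: trivial_ker_iff_det not_False_eq_True)
  ultimately show False by blast
qed

text \<open>All roots of the polynomial \<open>det (M + t P)\<close> in \<open>t\<close> are negative reals.\<close>

lemma det_add_semidefinite:
  fixes M P :: "complex^'n^'n::finite"
  assumes pos: "\<And>v. v \<noteq> 0 \<Longrightarrow> sesq M v v \<in> \<real> \<and> 0 < Re (sesq M v v)"
    and psd: "\<And>v. sesq P v v \<in> \<real> \<and> 0 \<le> Re (sesq P v v)"
  obtains s :: real where "1 \<le> s" "det (M + P) = of_real s * det M"
proof -
  define q :: "complex poly" where "q = det (\<chi> j k. [:M $ j $ k, P $ j $ k:])"
  have q: "poly q t = det (M + (\<chi> j k. t * P $ j $ k))" for t
    by (simp add: q_def det_def poly_sum poly_prod)
  have [simp]: "(\<chi> j k. P $ j $ k) = P" "(\<chi> j k. 0) = (0 :: complex^'n^'n)" by (simp_all add: vec_eq_iff)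
  have q0: "poly q 0 = det M" and q1: "poly q 1 = det (M + P)"
    by (simp_all add: q)
  have nz: "det M \<noteq> 0" by (rule det_nz_of_definite) (use pos in force)
  then have "q \<noteq> 0" using q0 by auto
  have root: "\<exists>r>0. z = - of_real r" if z: "poly q z = 0" for z
  proof -
    \<comment> \<open>At a root the matrix is singular. Pairing with the conjugate of a kernel
      vector gives \<open>m + z * p = 0\<close> with \<open>m > 0\<close> and
      \<open>p \<ge> 0\<close>, which forces \<open>p > 0\<close> and
      \<open>z = - m / p\<close>.\<close>
    from z obtain x where x: "x \<noteq> 0" "(M + (\<chi> j k. z * P $ j $ k)) *v x = 0"
      unfolding q using trivial_ker_iff_det[of "M + (\<chi> j k. z * P $ j $ k)"] by blast
    define y where "y = (\<chi> i. cnj (x $ i))"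
    have "y \<noteq> 0" using x(1) by (auto simp: y_def vec_eq_iff)
    define m p where "m = Re (sesq M y y)" and "p = Re (sesq P y y)"
    then have m: "sesq M y y = of_real m" "m > 0" and p: "sesq P y y = of_real p" "p \<ge> 0"
      using pos[OF \<open>y \<noteq> 0\<close>] psd[of y] by (simp_all add: of_real_Re)
    have sum0: "of_real m + z * of_real p = 0"
      using sesq_mult_vec_0[OF x(2), of y] m p unfolding y_def[symmetric]
      by (simp add: sesq_add_matrix sesq_scale_matrix)
    then have "p \<noteq> 0" using m by auto
    have "z * of_real p = - of_real m"
      using sum0 by (metis add.inverse_unique)
    then have "z = - of_real m / of_real p"
      using \<open>p \<noteq> 0\<close> by (subst nonzero_eq_divide_eq) auto
    then have "z = - of_real (m / p)" by simp
    then show ?thesis using m p \<open>p \<noteq> 0\<close> by (intro exI[of _ "m / p"]) auto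
  qed
  define Z where "Z = {z. poly q z = 0}"
  have rootZ: "\<exists>r>0. z = - of_real r" if "z \<in> Z" for z
    using root that by (simp add: Z_def)
  \<comment> \<open>The quotient of the values of \<open>q\<close> at 1 and 0, read off from the
    factorization: a root \<open>z\<close> contributes
    \<open>(1 - z) / (0 - z) = 1 + 1 / (- z)\<close>, which is at least 1 for negative
    \<open>z\<close>.\<close>
  define s where "s = (\<Prod>z\<in>Z. (1 + 1 / (- Re z)) ^ order z q)"
  have dec: "poly q t = lead_coeff q * (\<Prod>z\<in>Z. (t - z) ^ order z q)" for t
    by (subst complex_poly_decompose[of q, symmetric]) (simp add: poly_prod Z_def)
  have fac: "(1 - z) ^ k = of_real ((1 + 1 / (- Re z)) ^ k) * (0 - z) ^ k" if "z \<in> Z" for z k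
  proof -
    obtain r where "r > 0" "z = - of_real r" using rootZ \<open>z \<in> Z\<close> by blast
    then have "1 - z = of_real (1 + 1 / (- Re z)) * (0 - z)"
      by (simp add: distrib_right)
    then show ?thesis by (simp only: power_mult_distrib of_real_power)
  qed
  have "(\<Prod>z\<in>Z. (1 - z) ^ order z q) = of_real s * (\<Prod>z\<in>Z. (0 - z) ^ order z q)"
    unfolding s_def of_real_prod prod.distrib[symmetric] by (intro prod.cong refl fac)
  then have "det (M + P) = of_real s * det M"
    unfolding q0[symmetric] q1[symmetric] dec by simp
  moreover have "1 \<le> s"
    unfolding s_def
  proof (intro prod_ge_1 one_le_power)
    fix z assume "z \<in> Z"
    then obtain r where "r > 0" "z = - of_real r" using rootZ by blast
    then show "1 \<le> 1 + 1 / (- Re z)" by simp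
  qed
  ultimately show thesis by (rule that[rotated])
qed

section \<open>The Levi form\<close>

definition D1 :: "('a::real_normed_vector \<Rightarrow> real) \<Rightarrow> 'a \<Rightarrow> 'a \<Rightarrow> real" where
  "D1 U x a = frechet_derivative U (at x) a"

definition D2 :: "('a::real_normed_vector \<Rightarrow> real) \<Rightarrow> 'a \<Rightarrow> 'a \<Rightarrow> 'a \<Rightarrow> real" where
  "D2 U x a b = frechet_derivative (\<lambda>y. D1 U y a) (at x) b"

definition C2_on :: "('a::real_normed_vector \<Rightarrow> real) \<Rightarrow> 'a set \<Rightarrow> bool" where
  "C2_on U S \<longleftrightarrow> open S \<and> Ck_on 2 U S"

lemma
  assumes "C2_on U S"
  shows C2_on_open: "open S"
    and C2_on_deriv: "x \<in> S \<Longrightarrow> (U has_derivative D1 U x) (at x)"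
    and C2_on_deriv2: "x \<in> S \<Longrightarrow> ((\<lambda>y. D1 U y a) has_derivative D2 U x a) (at x)"
    and C2_on_continuous: "continuous_on S (\<lambda>x. D2 U x a b)"
  using assms
  by (auto simp: C2_on_def D1_def[abs_def] D2_def[abs_def] numeral_2_eq_2 frechet_derivative_works[symmetric])

lemma linear_D1: "C2_on U S \<Longrightarrow> x \<in> S \<Longrightarrow> linear (D1 U x)"
  using C2_on_deriv has_derivative_linear by blast

lemma linear_D2_right: "C2_on U S \<Longrightarrow> x \<in> S \<Longrightarrow> linear (D2 U x a)"
  using C2_on_deriv2 has_derivative_linear by blast

text \<open>\<open>D1 U y\<close> is linear for every \<open>y\<close> in the open set, so the two
  sides agree as functions of \<open>y\<close> near \<open>x\<close>; uniqueness of the derivative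
  transfers the linearity.\<close>

lemma linear_D2_left:
  assumes U: "C2_on U S" and x: "x \<in> S"
  shows "linear (\<lambda>a. D2 U x a b)"
proof
  fix a a' :: 'a and r :: real
  have "((\<lambda>y. D1 U y (a + a')) has_derivative (\<lambda>b. D2 U x a b + D2 U x a' b)) (at x)"
    using has_derivative_add[OF C2_on_deriv2[OF U x, of a] C2_on_deriv2[OF U x, of a']] C2_on_open[OF U] x
    by (rule has_derivative_transform_within_open) (simp add: linear_add[OF linear_D1[OF U]])
  from has_derivative_unique[OF C2_on_deriv2[OF U x] this]
  show "D2 U x (a + a') b = D2 U x a b + D2 U x a' b" by metis
  have "((\<lambda>y. D1 U y (r *\<^sub>R a)) has_derivative (\<lambda>b. r *\<^sub>R D2 U x a b)) (at x)"
    using has_derivative_scaleR_right[OF C2_on_deriv2[OF U x, of a], of r] C2_on_open[OF U] x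
    by (rule has_derivative_transform_within_open) (simp add: linear_scale[OF linear_D1[OF U]])
  from has_derivative_unique[OF C2_on_deriv2[OF U x] this]
  show "D2 U x (r *\<^sub>R a) b = r *\<^sub>R D2 U x a b" by metis
qed

text \<open>The second-order chain rule. The direction in
  \<open>D1 U (\<gamma> s) (\<delta> s)\<close> moves with \<open>s\<close>, whereas
  \<open>D2\<close> differentiates \<open>D1\<close> in a fixed direction; hence the velocity is
  expanded in \<open>Basis\<close> and the product rule is applied termwise.\<close>

lemma second_derivative_along_curve:
  fixes U :: "'a::euclidean_space \<Rightarrow> real" and \<gamma> \<delta> :: "real \<Rightarrow> 'a"
  assumes U: "C2_on U S" and "0 < d"
    and S: "\<And>s. \<bar>s\<bar> < d \<Longrightarrow> \<gamma> s \<in> S"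
    and \<gamma>: "\<And>s. \<bar>s\<bar> < d \<Longrightarrow> (\<gamma> has_vector_derivative \<delta> s) (at s)"
    and \<delta>: "(\<delta> has_vector_derivative \<epsilon>) (at 0)"
  shows "\<And>s. \<bar>s\<bar> < d \<Longrightarrow> ((\<lambda>s. U (\<gamma> s)) has_real_derivative D1 U (\<gamma> s) (\<delta> s)) (at s)"
    and "((\<lambda>s. D1 U (\<gamma> s) (\<delta> s)) has_real_derivative D2 U (\<gamma> 0) (\<delta> 0) (\<delta> 0) + D1 U (\<gamma> 0) \<epsilon>) (at 0)"
proof -
  have chain: "((\<lambda>s. F (\<gamma> s)) has_real_derivative F' (\<delta> s)) (at s)"
    if "\<bar>s\<bar> < d" "(F has_derivative F') (at (\<gamma> s))" for s and F F' :: "'a \<Rightarrow> real"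
    using vector_derivative_diff_chain_within[OF \<gamma>[OF that(1)] has_derivative_at_withinI[OF that(2)]]
    by (simp add: o_def has_real_derivative_iff_has_vector_derivative)
  show "((\<lambda>s. U (\<gamma> s)) has_real_derivative D1 U (\<gamma> s) (\<delta> s)) (at s)" if "\<bar>s\<bar> < d" for s
    using chain[OF that C2_on_deriv[OF U S[OF that]]] .
  have expand: "D1 U x y = (\<Sum>b\<in>Basis. (y \<bullet> b) * D1 U x b)" if "x \<in> S" for x y
    using linear_sum[OF linear_D1[OF U that], of "\<lambda>b. (y \<bullet> b) *\<^sub>R b" Basis]
    by (simp add: euclidean_representation linear_scale[OF linear_D1[OF U that]])
  have "0 \<in> {-d<..<d}" "\<gamma> 0 \<in> S" using \<open>0 < d\<close> S[of 0] by auto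
  have d\<delta>: "((\<lambda>s. \<delta> s \<bullet> b) has_real_derivative \<epsilon> \<bullet> b) (at 0)" for b
    using bounded_linear.has_vector_derivative[OF bounded_linear_inner_left \<delta>]
    by (simp add: has_real_derivative_iff_has_vector_derivative)
  have "((\<lambda>s. \<Sum>b\<in>Basis. (\<delta> s \<bullet> b) * D1 U (\<gamma> s) b) has_real_derivative
      (\<Sum>b\<in>Basis. (\<epsilon> \<bullet> b) * D1 U (\<gamma> 0) b + D2 U (\<gamma> 0) b (\<delta> 0) * (\<delta> 0 \<bullet> b))) (at 0)"
    using \<open>0 < d\<close> by (intro DERIV_sum DERIV_mult d\<delta> chain C2_on_deriv2[OF U] \<open>\<gamma> 0 \<in> S\<close>) auto
  moreover have "(\<Sum>b\<in>Basis. (\<epsilon> \<bullet> b) * D1 U (\<gamma> 0) b + D2 U (\<gamma> 0) b (\<delta> 0) * (\<delta> 0 \<bullet> b)) =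
      D2 U (\<gamma> 0) (\<delta> 0) (\<delta> 0) + D1 U (\<gamma> 0) \<epsilon>"
  proof -
    note lin = linear_D2_left[OF U \<open>\<gamma> 0 \<in> S\<close>, of "\<delta> 0"]
    have "D2 U (\<gamma> 0) (\<delta> 0) (\<delta> 0) = (\<Sum>b\<in>Basis. (\<delta> 0 \<bullet> b) * D2 U (\<gamma> 0) b (\<delta> 0))"
      using linear_sum[OF lin, of "\<lambda>b. (\<delta> 0 \<bullet> b) *\<^sub>R b" Basis]
      by (simp add: euclidean_representation linear_scale[OF lin])
    then show ?thesis
      using expand[OF \<open>\<gamma> 0 \<in> S\<close>, of \<epsilon>] by (simp add: sum.distrib mult.commute)
  qed
  ultimately show "((\<lambda>s. D1 U (\<gamma> s) (\<delta> s)) has_real_derivative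
      D2 U (\<gamma> 0) (\<delta> 0) (\<delta> 0) + D1 U (\<gamma> 0) \<epsilon>) (at 0)"
    using has_field_derivative_transform_within_open[of _ _ 0 "{-d<..<d}"] \<open>0 \<in> {-d<..<d}\<close> S
    by (auto simp: expand abs_less_iff)
qed

lemma second_derivative_unique:
  fixes f h :: "real \<Rightarrow> real"
  assumes "0 < d" and eq: "\<And>s. \<bar>s\<bar> < d \<Longrightarrow> f s = h s"
    and f: "\<And>s. \<bar>s\<bar> < d \<Longrightarrow> (f has_real_derivative f' s) (at s)" "(f' has_real_derivative a) (at 0)"
    and h: "\<And>s. \<bar>s\<bar> < d \<Longrightarrow> (h has_real_derivative h' s) (at s)" "(h' has_real_derivative b) (at 0)"
  shows "a = b"
proof -
  have "f' s = h' s" if s: "\<bar>s\<bar> < d" for s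
  proof -
    have "(f has_real_derivative h' s) (at s)"
      by (rule has_field_derivative_transform_within_open[OF h(1)[OF s], of "{-d<..<d}"]) (use s eq in auto)
    then show ?thesis using f(1)[OF s] DERIV_unique by blast
  qed
  then have "(f' has_real_derivative b) (at 0)"
    by (intro has_field_derivative_transform_within_open[OF h(2), of "{-d<..<d}"]) (use \<open>0 < d\<close> in auto)
  then show ?thesis using f(2) DERIV_unique by blast
qed

text \<open>If \<open>a\<close> were negative, \<open>f'\<close> would be negative just to the right
  of its zero at 0, and \<open>f\<close> would drop below its minimum.\<close>

lemma second_derivative_nonneg_at_min:
  fixes f :: "real \<Rightarrow> real"
  assumes "0 < d" and min: "\<And>s. \<bar>s\<bar> < d \<Longrightarrow> f 0 \<le> f s"
    and f: "\<And>s. \<bar>s\<bar> < d \<Longrightarrow> (f has_real_derivative f' s) (at s)" "(f' has_real_derivative a) (at 0)"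
  shows "0 \<le> a"
proof (rule ccontr)
  assume "\<not> 0 \<le> a"
  then obtain e where e: "e > 0" "\<And>s. 0 < s \<Longrightarrow> s < e \<Longrightarrow> f' s < f' 0"
    using DERIV_neg_dec_right[OF f(2)] by auto
  have "f' 0 = 0"
    using DERIV_local_min[OF f(1)[of 0] \<open>0 < d\<close>] min \<open>0 < d\<close> by auto
  define s where "s = min d e / 2"
  have s: "0 < s" "s < d" "s < e" using \<open>0 < d\<close> e(1) by (auto simp: s_def)
  have "f s < f 0"
  proof (rule DERIV_neg_imp_decreasing_open[OF s(1)])
    show "\<exists>y. (f has_real_derivative y) (at x) \<and> y < 0" if "0 < x" "x < s" for x
      using f(1)[of x] e(2)[of x] that s \<open>f' 0 = 0\<close> by auto
    show "continuous_on {0..s} f"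
      using f(1) s by (intro DERIV_atLeastAtMost_imp_continuous_on) (metis abs_of_nonneg le_less_trans)
  qed
  then show False using min[of s] s by auto
qed

lemma has_derivative_vec_nth_iff:
  fixes f :: "'a::real_normed_vector \<Rightarrow> 'b::real_normed_vector^'n::finite"
  shows "(f has_derivative f') (at x) \<longleftrightarrow> (\<forall>i. ((\<lambda>x. f x $ i) has_derivative (\<lambda>h. f' h $ i)) (at x))"
proof
  assume "(f has_derivative f') (at x)"
  then show "\<forall>i. ((\<lambda>x. f x $ i) has_derivative (\<lambda>h. f' h $ i)) (at x)"
    using bounded_linear.has_derivative[OF bounded_linear_vec_nth] by blast
next
  assume *: "\<forall>i. ((\<lambda>x. f x $ i) has_derivative (\<lambda>h. f' h $ i)) (at x)"
  then have lin: "bounded_linear (\<lambda>h. f' h $ i)" for i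
    by (auto dest: has_derivative_bounded_linear)
  have "bounded_linear f'"
  proof (rule bounded_linear_intro[where K = "\<Sum>i\<in>UNIV. onorm (\<lambda>h. f' h $ i)"])
    fix h k :: 'a and r :: real
    show "f' (h + k) = f' h + f' k" "f' (r *\<^sub>R h) = r *\<^sub>R f' h"
      by (simp_all add: vec_eq_iff linear_add[OF bounded_linear.linear[OF lin]]
        linear_scale[OF bounded_linear.linear[OF lin]])
    have "norm (f' h) \<le> (\<Sum>i\<in>UNIV. norm (f' h $ i))"
      by (simp add: norm_vec_def L2_set_le_sum)
    also have "\<dots> \<le> (\<Sum>i\<in>UNIV. onorm (\<lambda>h. f' h $ i) * norm h)"
      by (intro sum_mono onorm lin)
    finally show "norm (f' h) \<le> norm h * (\<Sum>i\<in>UNIV. onorm (\<lambda>h. f' h $ i))"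
      by (simp add: sum_distrib_left mult.commute)
  qed
  moreover have "((\<lambda>y. ((f y - f x) - f' (y - x)) /\<^sub>R norm (y - x)) \<longlongrightarrow> 0) (at x)"
    using * by (intro vec_tendstoI) (simp add: has_derivative_at_within)
  ultimately show "(f has_derivative f') (at x)"
    by (simp add: has_derivative_at_within)
qed

lemma has_vector_derivative_vec_nth_iff:
  fixes f :: "real \<Rightarrow> 'b::real_normed_vector^'n::finite"
  shows "(f has_vector_derivative f') (at x) \<longleftrightarrow> (\<forall>i. ((\<lambda>x. f x $ i) has_vector_derivative f' $ i) (at x))"
  unfolding has_vector_derivative_def by (subst has_derivative_vec_nth_iff) simp

text \<open>Four times the Levi form of \<open>U\<close>.\<close>

definition levi :: "(complex^'n \<Rightarrow> real) \<Rightarrow> complex^'n \<Rightarrow> complex^'n::finite \<Rightarrow> real" where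
  "levi U x v = D2 U x v v + D2 U x (\<i> *s v) (\<i> *s v)"

definition cplx_hess :: "(complex^'n \<Rightarrow> real) \<Rightarrow> complex^'n \<Rightarrow> complex^'n^'n::finite" where
  "cplx_hess U x = (\<chi> j k. wirt j (wirt_bar k (\<lambda>z. complex_of_real (U z))) x)"

lemma scaleR_eq_vector_scalar: "(r *\<^sub>R x :: complex^'n) = complex_of_real r *s x"
  by (simp add: vec_eq_iff scaleR_conv_of_real[of r "x $ i" for i])

text \<open>The one-variable second-derivative test on the real lines through \<open>z\<close> in
  the directions \<open>v\<close> and \<open>\<i> *s v\<close>; the sum of the two inequalities is
  the claim.\<close>

lemma levi_le_of_min:
  fixes U V :: "complex^'n::finite \<Rightarrow> real"
  assumes U: "C2_on U S" and V: "C2_on V S" and z: "z \<in> S"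
    and min: "\<And>x. x \<in> S \<Longrightarrow> U z - V z \<le> U x - V x"
  shows "levi V z v \<le> levi U z v"
proof -
  have D2: "D2 V z w w \<le> D2 U z w w" for w
  proof -
    define \<gamma> where "\<gamma> = (\<lambda>s::real. z + s *\<^sub>R w)"
    have "continuous_on UNIV \<gamma>" by (auto simp: \<gamma>_def intro!: continuous_intros)
    then have "open (\<gamma> -` S)" using C2_on_open[OF U] by (auto simp: continuous_on_open_vimage)
    moreover have "0 \<in> \<gamma> -` S" using z by (simp add: \<gamma>_def)
    ultimately obtain d where d: "d > 0" "ball 0 d \<subseteq> \<gamma> -` S" by (rule openE)
    then have S: "\<gamma> s \<in> S" if "\<bar>s\<bar> < d" for s using that by auto
    have \<gamma>: "(\<gamma> has_vector_derivative w) (at s)" for s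
      unfolding \<gamma>_def by (auto intro!: derivative_eq_intros)
    have \<delta>: "((\<lambda>s::real. w) has_vector_derivative 0) (at 0)" by simp
    note CU = second_derivative_along_curve[OF U d(1) S \<gamma> \<delta>]
      and CV = second_derivative_along_curve[OF V d(1) S \<gamma> \<delta>]
    have [simp]: "\<gamma> 0 = z" by (simp add: \<gamma>_def)
    have "0 \<le> (D2 U (\<gamma> 0) w w + D1 U (\<gamma> 0) 0) - (D2 V (\<gamma> 0) w w + D1 V (\<gamma> 0) 0)"
      by (rule second_derivative_nonneg_at_min[OF d(1) _ DERIV_diff[OF CU(1) CV(1)] DERIV_diff[OF CU(2) CV(2)]])
         (auto intro!: min S)
    then show ?thesis
      by (simp add: linear_0[OF linear_D1[OF U z]] linear_0[OF linear_D1[OF V z]])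
  qed
  show ?thesis unfolding levi_def by (intro add_mono D2)
qed

text \<open>Only one-variable holomorphy is used: along the curve \<open>\<gamma> t = T (z + t v)\<close> the second-order terms
  of \<open>\<gamma>\<close> in the real and imaginary directions are \<open>\<gamma>'' 0\<close> and \<open>- \<gamma>'' 0\<close>, so their contributions to
  the Levi form cancel.\<close>

lemma levi_holomorphic_change:
  fixes U :: "complex^'n::finite \<Rightarrow> real" and V :: "complex^'n \<Rightarrow> real" and T :: "complex^'n \<Rightarrow> complex^'n"
  assumes U: "C2_on U S" and V: "C2_on V S'" and W: "open W" "W \<subseteq> S" "T ` W \<subseteq> S'"
    and T: "holomorphic_map_on W T" and UV: "\<And>x. x \<in> W \<Longrightarrow> U x = V (T x)" and z: "z \<in> W"
  shows "levi U z v = levi V (T z) (frechet_derivative T (at z) v)"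
proof -
  define aff where "aff = (\<lambda>t. z + t *s v)"
  have "continuous_on UNIV aff"
    unfolding aff_def vector_scalar_mult_def by (intro continuous_intros)
  then have "open (aff -` W)" using W(1) by (auto simp: continuous_on_open_vimage)
  moreover have "0 \<in> aff -` W" using z by (simp add: aff_def)
  ultimately obtain d where d: "d > 0" "ball 0 d \<subseteq> aff -` W" by (rule openE)
  then have inW: "z + t *s v \<in> W" if "cmod t < d" for t using that by (auto simp: aff_def)
  define \<gamma> where "\<gamma> = (\<lambda>t. T (z + t *s v))"
  define \<delta> where "\<delta> = (\<lambda>t. frechet_derivative T (at (z + t *s v)) v)"
  have T': "(T has_derivative frechet_derivative T (at x)) (at x)"
    and clin: "frechet_derivative T (at x) (c *s w) = c *s frechet_derivative T (at x) w" if "x \<in> W" for x c w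
    using T that frechet_derivative_at unfolding holomorphic_map_on_def by metis+
  have \<gamma>: "((\<lambda>t. \<gamma> t $ i) has_field_derivative \<delta> t $ i) (at t)" if "cmod t < d" for t i
  proof -
    have "((\<lambda>t. z + t *s v) has_derivative (\<lambda>t. t *s v)) (at t)"
      by (subst has_derivative_vec_nth_iff) (auto intro!: derivative_eq_intros)
    from has_derivative_compose[OF this T'[OF inW[OF that]]]
    have "((\<lambda>t. \<gamma> t $ i) has_derivative (\<lambda>h. frechet_derivative T (at (z + t *s v)) (h *s v) $ i)) (at t)"
      unfolding \<gamma>_def by (rule bounded_linear.has_derivative[OF bounded_linear_vec_nth])
    then show ?thesis
      by (simp add: clin[OF inW[OF that]] \<delta>_def has_field_derivative_def mult_commute_abs)
  qed
  \<comment> \<open>\<open>holomorphic_map_on\<close> provides one complex derivative only. The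
    second one is supplied by the one-variable theorem that the derivative of a holomorphic function
    is holomorphic, applied to each coordinate of \<open>\<gamma>\<close>.\<close>
  have "\<exists>e. ((\<lambda>t. \<delta> t $ i) has_field_derivative e) (at 0)" for i
  proof -
    have "(\<lambda>t. \<gamma> t $ i) holomorphic_on ball 0 d"
      unfolding holomorphic_on_open[OF open_ball] by (intro ballI exI, rule \<gamma>) simp
    then have "deriv (\<lambda>t. \<gamma> t $ i) holomorphic_on ball 0 d"
      by (intro holomorphic_deriv) auto
    moreover have "deriv (\<lambda>t. \<gamma> t $ i) t = \<delta> t $ i" if "t \<in> ball 0 d" for t
      using \<gamma> that by (intro DERIV_imp_deriv) auto
    ultimately have "(\<lambda>t. \<delta> t $ i) holomorphic_on ball 0 d"
      by (metis (no_types, lifting) holomorphic_cong)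
    then show ?thesis using d(1) by (auto simp: holomorphic_on_open)
  qed
  then obtain e where e: "\<And>i. ((\<lambda>t. \<delta> t $ i) has_field_derivative e i) (at 0)" by metis
  define \<epsilon> where "\<epsilon> = (\<chi> i. e i)"
  \<comment> \<open>The real curve \<open>\<lambda>s. \<gamma> (of_real s * c)\<close> has velocity
    \<open>c *s \<delta> 0\<close> and acceleration \<open>(c * c) *s \<epsilon>\<close> at 0. The
    cases \<open>c = 1\<close> and \<open>c = \<i>\<close> produce the two terms of the Levi form,
    with opposite accelerations.\<close>
  have second: "D2 U z (c *s v) (c *s v) = D2 V (T z) (c *s \<delta> 0) (c *s \<delta> 0) + D1 V (T z) ((c * c) *s \<epsilon>)"
    if c: "cmod c = 1" for c
  proof -
    have inW': "z + s *\<^sub>R (c *s v) \<in> W" if "\<bar>s\<bar> < d" for s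
      using inW[of "of_real s * c"] that c by (simp add: scaleR_eq_vector_scalar norm_mult)
    have line: "((\<lambda>s. z + s *\<^sub>R (c *s v)) has_vector_derivative c *s v) (at s)" for s
      by (auto intro!: derivative_eq_intros)
    have comp: "((\<lambda>s. F (of_real s * c)) has_vector_derivative c * F') (at s)"
      if "(F has_field_derivative F') (at (of_real s * c))" for F F' and s :: real
    proof -
      have "((\<lambda>s::real. of_real s * c) has_vector_derivative c) (at s)"
        by (auto intro!: derivative_eq_intros simp: has_vector_derivative_def scaleR_conv_of_real)
      from field_vector_diff_chain_at[OF this that] show ?thesis by (simp add: o_def)
    qed
    have curve: "((\<lambda>s. \<gamma> (of_real s * c)) has_vector_derivative c *s \<delta> (of_real s * c)) (at s)"
      if "\<bar>s\<bar> < d" for s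
      unfolding has_vector_derivative_vec_nth_iff using comp[OF \<gamma>] that c by (simp add: norm_mult)
    have curve2: "((\<lambda>s. c *s \<delta> (of_real s * c)) has_vector_derivative (c * c) *s \<epsilon>) (at 0)"
      unfolding has_vector_derivative_vec_nth_iff
      using comp[of _ _ 0, simplified, OF e] by (auto intro!: derivative_eq_intros simp: \<epsilon>_def)
    have S: "z + s *\<^sub>R (c *s v) \<in> S" and S': "\<gamma> (of_real s * c) \<in> S'"
      and eq: "U (z + s *\<^sub>R (c *s v)) = V (\<gamma> (of_real s * c))" if "\<bar>s\<bar> < d" for s
      using inW'[OF that] W UV by (auto simp: \<gamma>_def scaleR_eq_vector_scalar)
    have 0: "((\<lambda>s::real. c *s v) has_vector_derivative 0) (at 0)" by simp
    note CU = second_derivative_along_curve[OF U d(1) S line 0]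
    note CV = second_derivative_along_curve[OF V d(1) S' curve curve2]
    have "z \<in> S" using z W by auto
    show ?thesis
      using second_derivative_unique[OF d(1) eq CU CV]
      by (simp add: \<gamma>_def linear_0[OF linear_D1[OF U \<open>z \<in> S\<close>]])
  qed
  have "T z \<in> S'" using z W by auto
  from linear_add[OF linear_D1[OF V this], of \<epsilon> "- \<epsilon>"] linear_0[OF linear_D1[OF V this]]
  have "D1 V (T z) \<epsilon> + D1 V (T z) (- \<epsilon>) = 0" by simp
  moreover have "(-1) *s \<epsilon> = - \<epsilon>" by (simp add: vec_eq_iff)
  ultimately show ?thesis
    using second[of 1] second[of \<i>] by (simp add: levi_def \<delta>_def)
qed

lemma wirt_wirt_bar_eq:
  fixes U :: "complex^'n::finite \<Rightarrow> real"
  assumes U: "C2_on U S" and z: "z \<in> S"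
  shows "wirt j (wirt_bar k (\<lambda>x. complex_of_real (U x))) z =
    (D2 U z (axis k 1) (axis j 1) + \<i> * D2 U z (axis k \<i>) (axis j 1)
      - \<i> * D2 U z (axis k 1) (axis j \<i>) + D2 U z (axis k \<i>) (axis j \<i>)) / 4"
proof -
  \<comment> \<open>This is needed on all of \<open>S\<close>, not only at \<open>z\<close>, because
    the expression is differentiated once more.\<close>
  have 1: "wirt_bar k (\<lambda>x. complex_of_real (U x)) x =
      (of_real (D1 U x (axis k 1)) + \<i> * of_real (D1 U x (axis k \<i>))) / 2" if "x \<in> S" for x
    unfolding wirt_bar_def
    by (subst (1 2) frechet_derivative_at[OF has_derivative_of_real[OF C2_on_deriv[OF U that]], symmetric]) simp
  have "((\<lambda>x. (of_real (D1 U x (axis k 1)) + \<i> * of_real (D1 U x (axis k \<i>))) / 2) has_derivative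
      (\<lambda>b. (of_real (D2 U z (axis k 1) b) + \<i> * of_real (D2 U z (axis k \<i>) b)) / 2)) (at z)"
    by (auto intro!: derivative_eq_intros C2_on_deriv2[OF U z])
  then have "(wirt_bar k (\<lambda>x. complex_of_real (U x)) has_derivative
      (\<lambda>b. (of_real (D2 U z (axis k 1) b) + \<i> * of_real (D2 U z (axis k \<i>) b)) / 2)) (at z)"
    by (rule has_derivative_transform_within_open[OF _ C2_on_open[OF U] z]) (simp add: 1)
  from frechet_derivative_at[OF this, symmetric] show ?thesis
    unfolding wirt_def by (simp add: field_simps)
qed

lemma Re_sesq_cplx_hess:
  fixes U :: "complex^'n::finite \<Rightarrow> real"
  assumes U: "C2_on U S" and z: "z \<in> S"
  shows "4 * Re (sesq (cplx_hess U z) v v) = levi U z v"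
proof -
  \<comment> \<open>\<open>q\<close> makes the real bilinear form \<open>D2 U z\<close>
    conjugate-linear in the first and linear in the second argument. On coordinate vectors it is
    four times the complex Hessian, and the real part of its diagonal is
    \<open>levi\<close>.\<close>
  define q where "q a b = complex_of_real (D2 U z a b) + \<i> * D2 U z (\<i> *s a) b
      - \<i> * D2 U z a (\<i> *s b) + D2 U z (\<i> *s a) (\<i> *s b)" for a b
  note L = linear_D2_left[OF U z] and R = linear_D2_right[OF U z]
  have split: "c *s a = Re c *\<^sub>R a + Im c *\<^sub>R (\<i> *s a)" for c and a :: "complex^'n"
    by (simp add: vec_eq_iff complex_eq_iff algebra_simps)
  have i_scale: "\<i> *s (r *\<^sub>R a) = r *\<^sub>R (\<i> *s a)" "\<i> *s (\<i> *s a) = - a" for r and a :: "complex^'n"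
    by (simp_all add: vec_eq_iff complex_eq_iff)
  have i_add: "\<i> *s (a + a') = \<i> *s a + \<i> *s a'" for a a' :: "complex^'n"
    by (simp add: vec_eq_iff algebra_simps)
  have add: "q (a + a') b = q a b + q a' b" "q a (b + b') = q a b + q a b'" for a a' b b'
    by (simp_all add: q_def i_add linear_add[OF L] linear_add[OF R] algebra_simps)
  have scale: "q (c *s a) b = cnj c * q a b" "q a (c *s b) = c * q a b" for a b c
    unfolding q_def split[of c]
    by (simp_all add: i_add i_scale linear_add[OF L] linear_add[OF R] linear_neg[OF L] linear_neg[OF R]
      linear_diff[OF L] linear_diff[OF R]
      linear_scale[OF L] linear_scale[OF R] complex_eq_iff algebra_simps)
  have q0: "q 0 b = 0" "q a 0 = 0" for a b
    using scale(1)[of 0 0 b] scale(2)[of a 0 0] by simp_all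
  have sum: "q (\<Sum>i\<in>I. f i) b = (\<Sum>i\<in>I. q (f i) b)" "q b (\<Sum>i\<in>I. f i) = (\<Sum>i\<in>I. q b (f i))"
    for f :: "'n \<Rightarrow> complex^'n" and I b
    by (induction I rule: infinite_finite_induct) (simp_all add: q0 add)
  have ax: "\<i> *s axis k 1 = (axis k \<i> :: complex^'n)" for k
    by (simp add: vec_eq_iff axis_def)
  have "q v v = q (\<Sum>k\<in>UNIV. v $ k *s axis k 1) (\<Sum>j\<in>UNIV. v $ j *s axis j 1)"
    by (simp add: basis_expansion)
  also have "\<dots> = (\<Sum>j\<in>UNIV. \<Sum>k\<in>UNIV. v $ j * (cnj (v $ k) * q (axis k 1) (axis j 1)))"
    by (simp add: sum scale sum_distrib_left)
  also have "\<dots> = 4 * sesq (cplx_hess U z) v v"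
  proof -
    have "q (axis k 1) (axis j 1) = 4 * cplx_hess U z $ j $ k" for j k
      by (simp add: cplx_hess_def wirt_wirt_bar_eq[OF U z] q_def ax)
    then show ?thesis
      by (simp add: sesq_def sum_distrib_left algebra_simps)
  qed
  finally have "4 * Re (sesq (cplx_hess U z) v v) = Re (q v v)" by simp
  then show ?thesis by (simp add: q_def levi_def)
qed

lemma continuous_on_cplx_hess:
  fixes U :: "complex^'n::finite \<Rightarrow> real"
  assumes U: "C2_on U S"
  shows "continuous_on S (\<lambda>z. cplx_hess U z $ j $ k)"
proof -
  have "continuous_on S (\<lambda>z. (D2 U z (axis k 1) (axis j 1) + \<i> * D2 U z (axis k \<i>) (axis j 1)
      - \<i> * D2 U z (axis k 1) (axis j \<i>) + D2 U z (axis k \<i>) (axis j \<i>)) / 4)"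
    by (intro continuous_intros C2_on_continuous[OF U]) auto
  then show ?thesis
    by (simp add: cplx_hess_def wirt_wirt_bar_eq[OF U] cong: continuous_on_cong)
qed

section \<open>Quotients of volume forms on a manifold\<close>

lemma
  assumes M: "complex_manifold X A" and \<kappa>: "\<kappa> \<in> A"
  shows chart_dom_openin: "openin X (chart_dom \<kappa>)"
    and coord_image_open: "\<And>W. openin X W \<Longrightarrow> W \<subseteq> chart_dom \<kappa> \<Longrightarrow> open (coord \<kappa> ` W)"
    and coord_continuous_map: "continuous_map (subtopology X (chart_dom \<kappa>)) euclidean (coord \<kappa>)"
    and coord_inj_on: "inj_on (coord \<kappa>) (chart_dom \<kappa>)"
proof -
  let ?D = "chart_dom \<kappa>"
  have op: "openin X ?D" "open (coord \<kappa> ` ?D)"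
    and hom: "homeomorphic_map (subtopology X ?D) (top_of_set (coord \<kappa> ` ?D)) (coord \<kappa>)"
    using assms by (auto simp: complex_manifold_def is_chart_def)
  show "openin X ?D" by fact
  have top: "topspace (subtopology X ?D) = ?D"
    using openin_subset[OF op(1)] by (auto simp: topspace_subtopology)
  show "inj_on (coord \<kappa>) ?D"
    using hom unfolding homeomorphic_eq_everything_map top by blast
  show "continuous_map (subtopology X ?D) euclidean (coord \<kappa>)"
    using homeomorphic_imp_continuous_map[OF hom] continuous_map_into_fulltopology by blast
  show "open (coord \<kappa> ` W)" if "openin X W" "W \<subseteq> ?D" for W
  proof -
    have "openin (subtopology X ?D) W"
      using that by (auto simp: openin_subtopology)
    then have "openin (top_of_set (coord \<kappa> ` ?D)) (coord \<kappa> ` W)"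
      using homeomorphic_imp_open_map[OF hom] by (auto simp: open_map_def)
    then show ?thesis using op(2) openin_open_trans by blast
  qed
qed

lemma
  assumes "complex_manifold X A" and "\<kappa> \<in> A"
  shows chart_inv_coord: "p \<in> chart_dom \<kappa> \<Longrightarrow> chart_inv \<kappa> (coord \<kappa> p) = p"
    and coord_chart_inv: "z \<in> coord \<kappa> ` chart_dom \<kappa> \<Longrightarrow> coord \<kappa> (chart_inv \<kappa> z) = z"
    and chart_inv_in_dom: "z \<in> coord \<kappa> ` chart_dom \<kappa> \<Longrightarrow> chart_inv \<kappa> z \<in> chart_dom \<kappa>"
  using coord_inj_on[OF assms] by (auto simp: chart_inv_def)

lemma C2_on_chart:
  assumes "complex_manifold X A" and "\<kappa> \<in> A" and "smooth_fun A u"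
  shows "C2_on (\<lambda>z. u (chart_inv \<kappa> z)) (coord \<kappa> ` chart_dom \<kappa>)"
  using assms coord_image_open[OF assms(1,2) chart_dom_openin[OF assms(1,2)]]
  by (auto simp: C2_on_def smooth_fun_def smooth_on_def o_def)

lemma continuous_map_charts:
  fixes F :: "'a \<Rightarrow> real"
  assumes M: "complex_manifold X A"
    and F: "\<And>\<kappa>. \<kappa> \<in> A \<Longrightarrow> continuous_on (coord \<kappa> ` chart_dom \<kappa>) (\<lambda>z. F (chart_inv \<kappa> z))"
  shows "continuous_map X euclideanreal F"
proof (rule pasting_lemma[where I = A and T = chart_dom and f = "\<lambda>_. F"])
  fix \<kappa> assume \<kappa>: "\<kappa> \<in> A"
  show "openin X (chart_dom \<kappa>)" by (rule chart_dom_openin[OF M \<kappa>])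
  let ?X = "subtopology X (chart_dom \<kappa>)"
  have "continuous_map ?X (top_of_set (coord \<kappa> ` chart_dom \<kappa>)) (coord \<kappa>)"
    using coord_continuous_map[OF M \<kappa>] by (auto simp: continuous_map_in_subtopology)
  moreover have "continuous_map (top_of_set (coord \<kappa> ` chart_dom \<kappa>)) euclideanreal (\<lambda>z. F (chart_inv \<kappa> z))"
    using F[OF \<kappa>] by simp
  ultimately have "continuous_map ?X euclideanreal ((\<lambda>z. F (chart_inv \<kappa> z)) \<circ> coord \<kappa>)"
    by (rule continuous_map_compose)
  then show "continuous_map ?X euclideanreal F"
    by (rule continuous_map_eq) (auto simp: chart_inv_coord[OF M \<kappa>])
next
  fix p assume "p \<in> topspace X"
  then show "\<exists>\<kappa>. \<kappa> \<in> A \<and> p \<in> chart_dom \<kappa> \<and> F p = F p"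
    using M unfolding complex_manifold_def by blast
qed auto

lemma continuous_map_smooth_fun:
  assumes "complex_manifold X A" and "smooth_fun A u"
  shows "continuous_map X euclideanreal u"
proof (rule continuous_map_charts[OF assms(1)])
  fix \<kappa> assume "\<kappa> \<in> A"
  then have "Ck_on 0 (u \<circ> chart_inv \<kappa>) (coord \<kappa> ` chart_dom \<kappa>)"
    using assms(2) unfolding smooth_fun_def smooth_on_def by blast
  then show "continuous_on (coord \<kappa> ` chart_dom \<kappa>) (\<lambda>z. u (chart_inv \<kappa> z))"
    by (simp add: o_def)
qed

lemma continuous_map_attains_sup_compact_space:
  fixes F :: "'a \<Rightarrow> real"
  assumes "compact_space X" "topspace X \<noteq> {}" "continuous_map X euclideanreal F"
  shows "\<exists>q\<in>topspace X. \<forall>p\<in>topspace X. F p \<le> F q"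
proof -
  have "compact (F ` topspace X)"
    using image_compactin[of X "topspace X" euclideanreal F] assms by (simp add: compact_space_def)
  then obtain m where "m \<in> F ` topspace X" "\<forall>y\<in>F ` topspace X. y \<le> m"
    using compact_attains_sup assms(2) by (metis image_is_empty)
  then show ?thesis by auto
qed

lemma max_over_eq:
  assumes "q \<in> S" "\<And>p. p \<in> S \<Longrightarrow> F p \<le> F q"
  shows "max_over S F = F q"
  unfolding max_over_def using assms by (intro Greatest_equality) auto

section \<open>Coefficient matrices of the forms and their behaviour under changes of charts\<close>

definition psh_matrix ::
    "(('a, 'n) chart \<Rightarrow> 'a \<Rightarrow> complex^'n^'n) \<Rightarrow> ('a \<Rightarrow> real) \<Rightarrow> ('a, 'n::finite) chart \<Rightarrow> 'a \<Rightarrow> complex^'n^'n" where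
  "psh_matrix g u \<kappa> p = g \<kappa> p + cplx_hess (\<lambda>z. u (chart_inv \<kappa> z)) (coord \<kappa> p)"

lemma form11_add: "form11 (M + N) v = form11 M v + form11 N v"
  by (simp add: form11_eq_sesq sesq_add_matrix)

lemma dform_add_i_ddbar:
  "dform_add (metric_form g) (i_ddbar u) \<kappa> p = (\<lambda>v. \<i> * form11 (psh_matrix g u \<kappa> p) v)"
  by (simp add: dform_add_def metric_form_def i_ddbar_def psh_matrix_def cplx_hess_def form11_add algebra_simps)

lemma form_J_form11: "form_J (\<lambda>v. \<i> * form11 M v) w = 2 * sesq M w w"
  by (simp add: form_J_def form11_eq_sesq sesq_scale algebra_simps)

lemma hermitian_metric_pos:
  assumes "hermitian_metric A g" "\<kappa> \<in> A" "p \<in> chart_dom \<kappa>" "v \<noteq> 0"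
  shows "sesq (g \<kappa> p) v v \<in> \<real>" "0 < Re (sesq (g \<kappa> p) v v)"
proof -
  have "positive_form (\<lambda>v. \<i> * form11 (g \<kappa> p) v)"
    using assms unfolding hermitian_metric_def metric_form_def by blast
  then show "sesq (g \<kappa> p) v v \<in> \<real>" "0 < Re (sesq (g \<kappa> p) v v)"
    using \<open>v \<noteq> 0\<close> by (auto simp: positive_form_def form_J_form11 complex_is_Real_iff)
qed

lemma hermitian_metric_real:
  assumes "hermitian_metric A g" "\<kappa> \<in> A" "p \<in> chart_dom \<kappa>"
  shows "sesq (g \<kappa> p) v v \<in> \<real>"
  using hermitian_metric_pos(1)[OF assms, of v] by (cases "v = 0") (auto simp: sesq_def)

lemma hermitian_metric_det:
  fixes g :: "('a, 'n::finite) chart \<Rightarrow> 'a \<Rightarrow> complex^'n^'n"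
  assumes "hermitian_metric A g" "\<kappa> \<in> A" "p \<in> chart_dom \<kappa>"
  shows "det (g \<kappa> p) \<noteq> 0"
proof (rule det_nz_of_definite)
  fix v :: "complex^'n" assume "v \<noteq> 0"
  then show "sesq (g \<kappa> p) v v \<noteq> 0" using hermitian_metric_pos(2)[OF assms, of v] by auto
qed

lemma psh_matrix_semidefinite:
  assumes "u \<in> smooth_PSH A (metric_form g)" "\<kappa> \<in> A" "p \<in> chart_dom \<kappa>"
  shows "sesq (psh_matrix g u \<kappa> p) v v \<in> \<real> \<and> 0 \<le> Re (sesq (psh_matrix g u \<kappa> p) v v)"
proof -
  have "semipositive_form (\<lambda>v. \<i> * form11 (psh_matrix g u \<kappa> p) v)"
    using assms unfolding smooth_PSH_def dform_add_i_ddbar by blast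
  then show ?thesis
    by (auto simp: semipositive_form_def form_J_form11 complex_is_Real_iff)
qed

text \<open>\<open>J\<close> is the complex Jacobian matrix of the transition map. The point is that
  one \<open>J\<close> serves both matrices: the two determinants are multiplied by the same factor,
  and their ratio is invariant.\<close>

lemma change_of_charts:
  fixes g :: "('a, 'n::finite) chart \<Rightarrow> 'a \<Rightarrow> complex^'n^'n"
  assumes M: "complex_manifold X A" and g: "hermitian_metric A g"
    and u: "u \<in> smooth_PSH A (metric_form g)"
    and \<kappa>: "\<kappa> \<in> A" "p \<in> chart_dom \<kappa>" and \<kappa>': "\<kappa>' \<in> A" "p \<in> chart_dom \<kappa>'"
  obtains J where "g \<kappa> p = transpose J ** g \<kappa>' p ** map_matrix cnj J"
    "psh_matrix g u \<kappa> p = transpose J ** psh_matrix g u \<kappa>' p ** map_matrix cnj J"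
proof -
  define T where "T = transition \<kappa> \<kappa>'"
  define W where "W = coord \<kappa> ` (chart_dom \<kappa> \<inter> chart_dom \<kappa>')"
  define z where "z = coord \<kappa> p"
  define L where "L = frechet_derivative T (at z)"
  have "openin X (chart_dom \<kappa> \<inter> chart_dom \<kappa>')"
    using chart_dom_openin[OF M] \<kappa> \<kappa>' by blast
  then have W: "open W" "W \<subseteq> coord \<kappa> ` chart_dom \<kappa>" "z \<in> W"
    unfolding W_def z_def using coord_image_open[OF M \<kappa>(1)] \<kappa> \<kappa>' by auto
  have T: "holomorphic_map_on W T"
    using M \<kappa> \<kappa>' by (auto simp: complex_manifold_def W_def T_def)
  have T_coord: "T (coord \<kappa> q) = coord \<kappa>' q" if "q \<in> chart_dom \<kappa>" for q
    using that by (simp add: T_def transition_def chart_inv_coord[OF M \<kappa>(1)])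
  obtain L' where L': "(T has_derivative L') (at z)" "\<And>c v. L' (c *s v) = c *s L' v"
    using T W(3) unfolding holomorphic_map_on_def by blast
  have L_L': "L = L'" unfolding L_def using frechet_derivative_at[OF L'(1)] by simp
  \<comment> \<open>Holomorphy makes the real derivative \<open>L\<close> complex linear, so that it
    is given by a complex matrix.\<close>
  have "Vector_Spaces.linear (*s) (*s) L"
    unfolding L_L' using linear_add[OF has_derivative_linear[OF L'(1)]] L'(2)
    by (unfold_locales) auto
  then have J: "matrix L *v v = L v" for v by (rule matrix_works)
  have g_eq: "sesq (g \<kappa> p) v v = sesq (g \<kappa>' p) (L v) (L v)" for v
  proof -
    have "metric_form g \<kappa> p w = metric_form g \<kappa>' p (\<lambda>i. L (w i))" for w
      using g \<kappa> \<kappa>' unfolding hermitian_metric_def L_def T_def z_def by blast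
    from this[of "\<lambda>i. if i = 0 then v else \<i> *s v"]
    have "form_J (metric_form g \<kappa> p) v = form_J (metric_form g \<kappa>' p) (L v)"
      by (simp add: form_J_def L_L' L'(2) if_distrib[of L'] cong: if_cong)
    then show ?thesis by (simp add: metric_form_def form_J_form11)
  qed
  have su: "smooth_fun A u" using u by (simp add: smooth_PSH_def)
  have "levi (\<lambda>z. u (chart_inv \<kappa> z)) z v = levi (\<lambda>z. u (chart_inv \<kappa>' z)) (T z) (L v)" for v
    unfolding L_def
  proof (rule levi_holomorphic_change[OF C2_on_chart[OF M \<kappa>(1) su] C2_on_chart[OF M \<kappa>'(1) su] W(1,2) _ T _ W(3)])
    show "T ` W \<subseteq> coord \<kappa>' ` chart_dom \<kappa>'"
      by (auto simp: W_def T_coord)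
    show "u (chart_inv \<kappa> x) = u (chart_inv \<kappa>' (T x))" if "x \<in> W" for x
      using that by (auto simp: W_def T_coord chart_inv_coord[OF M \<kappa>(1)] chart_inv_coord[OF M \<kappa>'(1)])
  qed
  then have "Re (sesq (cplx_hess (\<lambda>z. u (chart_inv \<kappa> z)) (coord \<kappa> p)) v v) =
      Re (sesq (cplx_hess (\<lambda>z. u (chart_inv \<kappa>' z)) (coord \<kappa>' p)) (L v) (L v))" for v
    using Re_sesq_cplx_hess[OF C2_on_chart[OF M \<kappa>(1) su], of z v]
      Re_sesq_cplx_hess[OF C2_on_chart[OF M \<kappa>'(1) su], of "T z" "L v"] \<kappa> \<kappa>'
    by (simp add: z_def T_coord)
  then have "Re (sesq (psh_matrix g u \<kappa> p) v v) = Re (sesq (psh_matrix g u \<kappa>' p) (L v) (L v))" for v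
    by (simp add: psh_matrix_def sesq_add_matrix g_eq)
  \<comment> \<open>The Levi form controls real parts only; semidefiniteness makes the values on
    both sides real.\<close>
  then have psh_eq: "sesq (psh_matrix g u \<kappa> p) v v = sesq (psh_matrix g u \<kappa>' p) (L v) (L v)" for v
    using psh_matrix_semidefinite[OF u \<kappa>] psh_matrix_semidefinite[OF u \<kappa>']
    by (auto simp: complex_eq_iff complex_is_Real_iff)
  show thesis
  proof (rule that[of "matrix L"]; rule matrix_eq_of_sesq_diag)
  qed (simp_all add: sesq_congruence J g_eq psh_eq)
qed

text \<open>Chart-dependent at first sight. Taking \<open>Re\<close> loses nothing, since both
  determinants are real by Hermitian symmetry.\<close>

definition volume_ratio ::
    "(('a, 'n) chart \<Rightarrow> 'a \<Rightarrow> complex^'n^'n) \<Rightarrow> ('a \<Rightarrow> real) \<Rightarrow> ('a, 'n::finite) chart \<Rightarrow> 'a \<Rightarrow> real" where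
  "volume_ratio g u \<kappa> p = Re (det (psh_matrix g u \<kappa> p) / det (g \<kappa> p))"

lemma det_psh_matrix:
  assumes "hermitian_metric A g" and "u \<in> smooth_PSH A (metric_form g)" and "\<kappa> \<in> A" "p \<in> chart_dom \<kappa>"
  shows "det (psh_matrix g u \<kappa> p) = of_real (volume_ratio g u \<kappa> p) * det (g \<kappa> p)"
proof -
  have "det (psh_matrix g u \<kappa> p) \<in> \<real>" "det (g \<kappa> p) \<in> \<real>"
    using psh_matrix_semidefinite[OF assms(2-4)] hermitian_metric_real[OF assms(1,3,4)]
    by (auto intro!: det_hermitian_real)
  then have "det (psh_matrix g u \<kappa> p) / det (g \<kappa> p) = of_real (volume_ratio g u \<kappa> p)"
    by (simp add: volume_ratio_def of_real_Re)
  then show ?thesis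
    using hermitian_metric_det[OF assms(1,3,4)] by (simp add: divide_eq_eq)
qed

text \<open>A factor \<open>f\<close> is determined already in the chart \<open>\<kappa>\<close>, by
  evaluation where \<open>volume_form\<close> does not vanish. Conversely the ratio found in
  \<open>\<kappa>\<close> works in every other chart around \<open>p\<close>, since the determinants
  transform alike.\<close>

lemma dform_scaled_at_iff:
  fixes g :: "('a, 'n::finite) chart \<Rightarrow> 'a \<Rightarrow> complex^'n^'n"
  assumes M: "complex_manifold X A" and g: "hermitian_metric A g"
    and u: "u \<in> smooth_PSH A (metric_form g)" and \<kappa>: "\<kappa> \<in> A" "p \<in> chart_dom \<kappa>"
  shows "dform_scaled_at A p (dform_power (dform_add (metric_form g) (i_ddbar u)) CARD('n)) f
      (dform_power (metric_form g) CARD('n)) \<longleftrightarrow> f = volume_ratio g u \<kappa> p"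
proof -
  have power: "dform_power (dform_add (metric_form g) (i_ddbar u)) CARD('n) \<kappa>' p v =
      \<i> ^ CARD('n) * det (psh_matrix g u \<kappa>' p) * volume_form v"
    "dform_power (metric_form g) CARD('n) \<kappa>' p v = \<i> ^ CARD('n) * det (g \<kappa>' p) * volume_form v" for \<kappa>' v
    unfolding dform_power_def dform_add_i_ddbar by (simp_all add: wedge_power_form11 metric_form_def)
  show ?thesis
  proof
    obtain v :: "nat \<Rightarrow> complex^'n" where v: "volume_form v \<noteq> 0"
      using volume_form_nonzero by blast
    assume "dform_scaled_at A p (dform_power (dform_add (metric_form g) (i_ddbar u)) CARD('n)) f
      (dform_power (metric_form g) CARD('n))"
    then have "\<i> ^ CARD('n) * det (psh_matrix g u \<kappa> p) * volume_form v =
        of_real f * (\<i> ^ CARD('n) * det (g \<kappa> p) * volume_form v)"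
      unfolding dform_scaled_at_def power using \<kappa> by blast
    then show "f = volume_ratio g u \<kappa> p"
      using v hermitian_metric_det[OF g \<kappa>] unfolding det_psh_matrix[OF g u \<kappa>] by simp
  next
    assume f: "f = volume_ratio g u \<kappa> p"
    have "det (psh_matrix g u \<kappa>' p) = of_real f * det (g \<kappa>' p)" if \<kappa>': "\<kappa>' \<in> A" "p \<in> chart_dom \<kappa>'" for \<kappa>'
    proof -
      obtain J where J: "g \<kappa>' p = transpose J ** g \<kappa> p ** map_matrix cnj J"
        "psh_matrix g u \<kappa>' p = transpose J ** psh_matrix g u \<kappa> p ** map_matrix cnj J"
        using change_of_charts[OF M g u \<kappa>' \<kappa>] .
      show ?thesis
        unfolding J det_mul by (simp add: det_psh_matrix[OF g u \<kappa>] f)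
    qed
    then show "dform_scaled_at A p (dform_power (dform_add (metric_form g) (i_ddbar u)) CARD('n)) f
      (dform_power (metric_form g) CARD('n))"
      unfolding dform_scaled_at_def power by simp
  qed
qed

lemma dform_quotient_eq:
  fixes g :: "('a, 'n::finite) chart \<Rightarrow> 'a \<Rightarrow> complex^'n^'n"
  assumes "complex_manifold X A" and "hermitian_metric A g"
    and "u \<in> smooth_PSH A (metric_form g)" and "\<kappa> \<in> A" "p \<in> chart_dom \<kappa>"
  shows "dform_quotient A (dform_power (dform_add (metric_form g) (i_ddbar u)) CARD('n))
      (dform_power (metric_form g) CARD('n)) p = volume_ratio g u \<kappa> p"
  unfolding dform_quotient_def dform_scaled_at_iff[OF assms] by simp

lemma continuous_on_det:
  fixes F :: "'b::topological_space \<Rightarrow> complex^'n^'n::finite"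
  assumes "\<And>j k. continuous_on S (\<lambda>z. F z $ j $ k)"
  shows "continuous_on S (\<lambda>z. det (F z))"
  unfolding det_def by (intro continuous_on_sum continuous_on_mult continuous_on_const continuous_on_prod assms)

lemma continuous_map_quotient:
  fixes g :: "('a, 'n::finite) chart \<Rightarrow> 'a \<Rightarrow> complex^'n^'n"
  assumes M: "complex_manifold X A" and g: "hermitian_metric A g"
    and u: "u \<in> smooth_PSH A (metric_form g)"
  shows "continuous_map X euclideanreal (dform_quotient A
    (dform_power (dform_add (metric_form g) (i_ddbar u)) CARD('n)) (dform_power (metric_form g) CARD('n)))"
proof (rule continuous_map_charts[OF M])
  fix \<kappa> assume \<kappa>: "\<kappa> \<in> A"
  let ?S = "coord \<kappa> ` chart_dom \<kappa>"
  let ?G = "\<lambda>z. g \<kappa> (chart_inv \<kappa> z)" and ?H = "cplx_hess (\<lambda>z. u (chart_inv \<kappa> z))"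
  have su: "smooth_fun A u" using u by (simp add: smooth_PSH_def)
  have "Ck_on 0 ?G ?S"
    using g \<kappa> unfolding hermitian_metric_def smooth_on_def by blast
  then have "continuous_on ?S ?G" by simp
  then have G: "continuous_on ?S (\<lambda>z. ?G z $ j $ k)" for j k
    by (intro continuous_intros)
  have H: "continuous_on ?S (\<lambda>z. ?H z $ j $ k)" for j k
    by (rule continuous_on_cplx_hess[OF C2_on_chart[OF M \<kappa> su]])
  have nz: "det (?G z) \<noteq> 0" if "z \<in> ?S" for z
    using hermitian_metric_det[OF g \<kappa>] chart_inv_in_dom[OF M \<kappa> that] by blast
  have "continuous_on ?S (\<lambda>z. Re (det (?G z + ?H z) / det (?G z)))"
    using nz
    by (intro continuous_on_Re continuous_on_divide continuous_on_det G)
      (auto intro: continuous_on_add[OF G H])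
  moreover have "dform_quotient A (dform_power (dform_add (metric_form g) (i_ddbar u)) CARD('n))
      (dform_power (metric_form g) CARD('n)) (chart_inv \<kappa> z) = Re (det (?G z + ?H z) / det (?G z))"
    if "z \<in> ?S" for z
    using dform_quotient_eq[OF M g u \<kappa> chart_inv_in_dom[OF M \<kappa> that]]
    by (simp add: volume_ratio_def psh_matrix_def coord_chart_inv[OF M \<kappa> that])
  ultimately show "continuous_on ?S (\<lambda>z. dform_quotient A
      (dform_power (dform_add (metric_form g) (i_ddbar u)) CARD('n)) (dform_power (metric_form g) CARD('n))
      (chart_inv \<kappa> z))"
    by (simp cong: continuous_on_cong)
qed

text \<open>The metric cancels in the difference \<open>P\<close> of the two matrices, which is the
  complex Hessian of \<open>u - \<phi>\<close> and is semidefinite at a minimum point. The larger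
  matrix therefore has the larger determinant.\<close>

lemma volume_ratio_le_at_min:
  fixes g :: "('a, 'n::finite) chart \<Rightarrow> 'a \<Rightarrow> complex^'n^'n"
  assumes M: "complex_manifold X A" and g: "hermitian_metric A g"
    and u: "u \<in> smooth_PSH A (metric_form g)" and \<phi>: "\<phi> \<in> smooth_PSH A (metric_form g)"
    and \<kappa>: "\<kappa> \<in> A" "p \<in> chart_dom \<kappa>"
    and min: "\<And>q. q \<in> topspace X \<Longrightarrow> u p - \<phi> p \<le> u q - \<phi> q"
    and pos: "0 < volume_ratio g \<phi> \<kappa> p"
  shows "volume_ratio g \<phi> \<kappa> p \<le> volume_ratio g u \<kappa> p"
proof -
  let ?S = "coord \<kappa> ` chart_dom \<kappa>" and ?z = "coord \<kappa> p"
  let ?U = "\<lambda>z. u (chart_inv \<kappa> z)" and ?V = "\<lambda>z. \<phi> (chart_inv \<kappa> z)"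
  have U: "C2_on ?U ?S" and V: "C2_on ?V ?S"
    using u \<phi> by (auto simp: smooth_PSH_def intro!: C2_on_chart[OF M \<kappa>(1)])
  have z: "?z \<in> ?S" using \<kappa> by simp
  have levi: "levi ?V ?z v \<le> levi ?U ?z v" for v
  proof (rule levi_le_of_min[OF U V z])
    fix x assume "x \<in> ?S"
    then have "chart_inv \<kappa> x \<in> topspace X"
      using chart_inv_in_dom[OF M \<kappa>(1)] openin_subset[OF chart_dom_openin[OF M \<kappa>(1)]] by blast
    then show "?U ?z - ?V ?z \<le> ?U x - ?V x"
      using min \<kappa> by (simp add: chart_inv_coord[OF M \<kappa>(1)])
  qed
  have le: "Re (sesq (psh_matrix g \<phi> \<kappa> p) v v) \<le> Re (sesq (psh_matrix g u \<kappa> p) v v)" for v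
  proof -
    have "Re (sesq (cplx_hess ?V ?z) v v) \<le> Re (sesq (cplx_hess ?U ?z) v v)"
      using Re_sesq_cplx_hess[OF U z, of v] Re_sesq_cplx_hess[OF V z, of v] levi[of v]
      by linarith
    then show ?thesis by (simp add: psh_matrix_def sesq_add_matrix)
  qed
  define P where "P = psh_matrix g u \<kappa> p - psh_matrix g \<phi> \<kappa> p"
  have sum: "psh_matrix g \<phi> \<kappa> p + P = psh_matrix g u \<kappa> p" by (simp add: P_def)
  \<comment> \<open>The hypothesis \<open>pos\<close> upgrades the semidefinite matrix of
    \<open>\<phi>\<close> to a definite one, as \<open>det_add_semidefinite\<close> demands of its
    first summand.\<close>
  have det\<phi>: "det (psh_matrix g \<phi> \<kappa> p) \<noteq> 0"
    using det_psh_matrix[OF g \<phi> \<kappa>] hermitian_metric_det[OF g \<kappa>] pos by simp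
  have P: "sesq P v v \<in> \<real> \<and> 0 \<le> Re (sesq P v v)" for v
  proof -
    have "sesq P v v = sesq (psh_matrix g u \<kappa> p) v v - sesq (psh_matrix g \<phi> \<kappa> p) v v"
      using sesq_add_matrix[of "psh_matrix g \<phi> \<kappa> p" P v v] by (simp add: sum)
    then show ?thesis
      using le[of v] psh_matrix_semidefinite[OF u \<kappa>, of v] psh_matrix_semidefinite[OF \<phi> \<kappa>, of v] by auto
  qed
  have def\<phi>: "sesq (psh_matrix g \<phi> \<kappa> p) v v \<in> \<real> \<and> 0 < Re (sesq (psh_matrix g \<phi> \<kappa> p) v v)" if "v \<noteq> 0" for v
    using definite_of_semidefinite[OF psh_matrix_semidefinite[OF \<phi> \<kappa>] det\<phi> that]
      psh_matrix_semidefinite[OF \<phi> \<kappa>] by blast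
  obtain s where s: "1 \<le> s" "det (psh_matrix g u \<kappa> p) = of_real s * det (psh_matrix g \<phi> \<kappa> p)"
    using det_add_semidefinite[of "psh_matrix g \<phi> \<kappa> p" P, OF def\<phi> P] unfolding sum .
  then have "complex_of_real (volume_ratio g u \<kappa> p) * det (g \<kappa> p) =
      of_real (s * volume_ratio g \<phi> \<kappa> p) * det (g \<kappa> p)"
    unfolding det_psh_matrix[OF g u \<kappa>] det_psh_matrix[OF g \<phi> \<kappa>] by simp
  then have "volume_ratio g u \<kappa> p = s * volume_ratio g \<phi> \<kappa> p"
    by (simp only: mult_cancel_right hermitian_metric_det[OF g \<kappa>] of_real_eq_iff simp_thms)
  then show ?thesis using s(1) pos by simp
qed

section \<open>Comparison of an arbitrary competitor with the solution\<close>

theorem corollary1p1: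
  fixes X :: "'a topology"
    and A :: "('a, 'n::finite) chart set"
    and g :: "('a, 'n) chart \<Rightarrow> 'a \<Rightarrow> complex^'n^'n"
    and \<omega> :: "('a, 'n) dform"
    and n :: nat
    and \<psi> \<phi> :: "'a \<Rightarrow> real"
    and c :: real
  assumes "complex_manifold X A" and "n = CARD('n)"
    and "compact_space X" and "connected_space X"
    and "hermitian_metric A g" and "\<omega> = metric_form g"
    and "smooth_fun A \<psi>"
    and "\<phi> \<in> smooth_PSH A \<omega>"
    and "\<forall>p\<in>topspace X. dform_scaled_at A p
           (dform_power (dform_add \<omega> (i_ddbar \<phi>)) n) (exp (\<psi> p + c)) (dform_power \<omega> n)"
    and "max_over (topspace X) \<phi> = 0"
  shows "exp c = (INF u\<in>smooth_PSH A \<omega>.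
           max_over (topspace X) (\<lambda>p. exp (- \<psi> p) *
             dform_quotient A (dform_power (dform_add \<omega> (i_ddbar u)) n) (dform_power \<omega> n) p))"
proof -
  note M = \<open>complex_manifold X A\<close> and g = \<open>hermitian_metric A g\<close>
  have \<phi>: "\<phi> \<in> smooth_PSH A (metric_form g)" using assms by simp
  have ne: "topspace X \<noteq> {}" and cover: "(\<Union>\<kappa>\<in>A. chart_dom \<kappa>) = topspace X"
    using M by (auto simp: complex_manifold_def)
  define F where "F u p = exp (- \<psi> p) * dform_quotient A (dform_power (dform_add \<omega> (i_ddbar u)) n)
    (dform_power \<omega> n) p" for u p
  have F: "F u p = exp (- \<psi> p) * volume_ratio g u \<kappa> p"
    if "u \<in> smooth_PSH A (metric_form g)" "\<kappa> \<in> A" "p \<in> chart_dom \<kappa>" for u \<kappa> p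
    using dform_quotient_eq[OF M g that] by (simp add: F_def \<open>\<omega> = metric_form g\<close> \<open>n = CARD('n)\<close>)
  \<comment> \<open>As a value of \<open>exp\<close> the ratio is positive, which is what the
    comparison at the minimum point asks for.\<close>
  have ratio_\<phi>: "volume_ratio g \<phi> \<kappa> p = exp (\<psi> p + c)" if "\<kappa> \<in> A" "p \<in> chart_dom \<kappa>" for \<kappa> p
  proof -
    have "p \<in> topspace X" using that cover by blast
    from bspec[OF assms(9) this] show ?thesis
      unfolding \<open>\<omega> = metric_form g\<close> \<open>n = CARD('n)\<close> dform_scaled_at_iff[OF M g \<phi> that] by simp
  qed
  have ex_chart: thesis if "x \<in> topspace X" "\<And>\<kappa>. \<kappa> \<in> A \<Longrightarrow> x \<in> chart_dom \<kappa> \<Longrightarrow> thesis" for x thesis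
    using that(1) unfolding cover[symmetric] by (elim UN_E) (rule that(2))
  have exp_cancel: "exp (- a) * exp (a + c) = exp c" for a
    by (simp add: exp_add exp_minus)
  have F_exp: "F \<phi> p = exp c" if "p \<in> topspace X" for p
  proof -
    obtain \<kappa> where \<kappa>: "\<kappa> \<in> A" "p \<in> chart_dom \<kappa>" using ex_chart[OF \<open>p \<in> topspace X\<close>] .
    show ?thesis unfolding F[OF \<phi> \<kappa>] ratio_\<phi>[OF \<kappa>] by (rule exp_cancel)
  qed
  obtain x where x: "x \<in> topspace X" using ne by blast
  have "max_over (topspace X) (F \<phi>) = F \<phi> x"
    by (rule max_over_eq[OF x]) (simp add: F_exp x)
  then have F_\<phi>: "max_over (topspace X) (F \<phi>) = exp c"
    using F_exp[OF x] by simp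
  have F_u: "exp c \<le> max_over (topspace X) (F u)" if u: "u \<in> smooth_PSH A (metric_form g)" for u
  proof -
    have cont: "continuous_map X euclideanreal (F u)"
    proof -
      have "continuous_map X euclideanreal (\<lambda>p. exp (- \<psi> p))"
        using continuous_map_compose[OF continuous_map_minus[OF continuous_map_smooth_fun[OF M \<open>smooth_fun A \<psi>\<close>]],
            of euclideanreal exp] continuous_on_exp[OF continuous_on_id, of "UNIV :: real set"]
        by (simp add: o_def)
      then show ?thesis
        unfolding F_def[abs_def] \<open>\<omega> = metric_form g\<close> \<open>n = CARD('n)\<close>
        by (rule continuous_map_real_mult[OF _ continuous_map_quotient[OF M g u]])
    qed
    \<comment> \<open>\<open>q\<close> is where \<open>F u\<close> is largest and justifies the use
      of \<open>max_over\<close>. It need not be the point \<open>p\<close> below, where the forms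
      are compared; the two are linked only by \<open>F u p \<le> F u q\<close>.\<close>
    obtain q where q: "q \<in> topspace X" "\<And>p. p \<in> topspace X \<Longrightarrow> F u p \<le> F u q"
      using bexE[OF continuous_map_attains_sup_compact_space[OF \<open>compact_space X\<close> ne cont]] bspec by metis
    have "smooth_fun A \<phi>" "smooth_fun A u"
      using u \<phi> by (simp_all add: smooth_PSH_def)
    then have cont_diff: "continuous_map X euclideanreal (\<lambda>p. \<phi> p - u p)"
      by (intro continuous_map_diff continuous_map_smooth_fun[OF M])
    obtain p where p: "p \<in> topspace X" "\<And>x. x \<in> topspace X \<Longrightarrow> \<phi> x - u x \<le> \<phi> p - u p"
      using bexE[OF continuous_map_attains_sup_compact_space[OF \<open>compact_space X\<close> ne cont_diff]] bspec by metis
    obtain \<kappa> where \<kappa>: "\<kappa> \<in> A" "p \<in> chart_dom \<kappa>" using ex_chart[OF p(1)] .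
    have "volume_ratio g \<phi> \<kappa> p \<le> volume_ratio g u \<kappa> p"
    proof (rule volume_ratio_le_at_min[OF M g u \<phi> \<kappa>])
      show "u p - \<phi> p \<le> u x - \<phi> x" if "x \<in> topspace X" for x
        using p(2)[OF that] by linarith
    qed (simp add: ratio_\<phi>[OF \<kappa>])
    then have "exp (- \<psi> p) * exp (\<psi> p + c) \<le> F u p"
      unfolding F[OF u \<kappa>] ratio_\<phi>[OF \<kappa>] by (intro mult_left_mono) auto
    then have "exp c \<le> F u p" unfolding exp_cancel .
    also have "\<dots> \<le> F u q" by (rule q(2)[OF p(1)])
    also have "\<dots> = max_over (topspace X) (F u)"
      using max_over_eq[of q "topspace X" "F u"] q by simp
    finally show ?thesis .
  qed
  \<comment> \<open>The bound \<open>F_u\<close> is attained by \<open>\<phi>\<close> itself, so the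
    infimum is a minimum and no separate argument about lower bounds is called for.\<close>
  have "(INF u\<in>smooth_PSH A (metric_form g). max_over (topspace X) (F u)) = exp c"
  proof (rule cInf_eq_minimum)
    show "exp c \<in> (\<lambda>u. max_over (topspace X) (F u)) ` smooth_PSH A (metric_form g)"
      using imageI[OF \<phi>, of "\<lambda>u. max_over (topspace X) (F u)"] F_\<phi> by simp
  qed (use F_u in blast)
  then show ?thesis
    unfolding F_def[abs_def] \<open>\<omega> = metric_form g\<close> by (rule sym)
qed

end
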